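(* Let $\alpha\in\mathbb{R}$ and $r>0$ be such that there are relatively prime $a,b\in\mathbb{Z}$ and $s>0$ with $e^{\frac{\pi \mathrm{i}}{2}\alpha} = \frac1s\left(\frac{a}{r}+\mathrm{i}br\right)$. Let $c,d\in\mathbb{Z}$ be such that $ad-bc=1$, let $t = \frac{ac}{r^2}+bdr^2$, and let $\mu_0\in\mathbb{C}\setminus\{0\}$ be the constant for which $$\mathcal{F}^\alpha Ш_r(x) = \mu_0\, e^{-\pi \mathrm{i} t x^2-\pi \mathrm{i} cdsx}\,Ш_{1/s}\!\left(x-\frac{ab}{2s}\right).$$ Then $\mu_0$ is an eighth root of unity ($\mu_0^8=1$), and $\mu_0$ depends only on $a,b,c,d$ and on whether or not $\alpha$ is congruent modulo $8$ to an element of $(-2,2]$.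
   Context: For $r>0$, the Dirac comb is the tempered distribution $Ш_r(x) = \sqrt{r}\sum_{k\in\mathbb{Z}}\delta(x-rk)\in\mathscr{S}'(\mathbb{R})$. Fractional Fourier transform: for $\alpha\in(-2,2)\setminus\{0\}$ and $f\in\mathscr{S}(\mathbb{R})$, $$\mathcal{F}^\alpha f(x) = \frac{1}{\sqrt{\mathrm{i}\sin(\pi\alpha/2)}}\int e^{\frac{\pi \mathrm{i}}{\sin(\pi\alpha/2)}(\cos(\pi\alpha/2)(x^2+y^2)-2xy)}f(y)\,dy,$$ with the square root having positive real part; $\mathcal{F}^0 f=f$; and $\mathcal{F}^2f(x) = -\mathrm{i}f(-x)$, so that the definition extends to all real exponents by $\mathcal{F}^{\alpha+2k}f(x) = e^{-\frac{\pi \mathrm{i}}{2}k}\mathcal{F}^\alpha f((-1)^kx)$ for $k\in\mathbb{Z}$, $\alpha\in(-2,2)$. Each $\mathcal{F}^\alpha$ is an automorphism of $\mathscr{S}(\mathbb{R})$ and extends (weakly continuously) to $\mathscr{S}'(\mathbb{R})$. A constant $\mu_0\neq0$ satisfying the displayed identity exists under the stated hypotheses, and it is unique since the distribution on the right-hand side is nonzero. *)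

theory Defs
  imports "HOL-Probability.Sinc_Integral"
begin

section \<open>Schwartz functions and tempered distributions\<close>

definition nth_deriv :: "nat \<Rightarrow> (real \<Rightarrow> complex) \<Rightarrow> real \<Rightarrow> complex" where
  "nth_deriv n f = ((\<lambda>g x. vector_derivative g (at x)) ^^ n) f"

definition schwartz :: "(real \<Rightarrow> complex) set" where
  "schwartz = {f. \<forall>n. (\<forall>x. nth_deriv n f differentiable (at x)) \<and>
                      (\<forall>m. bounded (range (\<lambda>x. x ^ m *\<^sub>R nth_deriv n f x)))}"

definition schwartz_seminorm :: "nat \<Rightarrow> nat \<Rightarrow> (real \<Rightarrow> complex) \<Rightarrow> real" where
  "schwartz_seminorm m n f = (SUP x. norm (x ^ m *\<^sub>R nth_deriv n f x))"

text \<open>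
  Distributions are functionals \<open>u :: (real \<Rightarrow> complex) \<Rightarrow> complex\<close>; only their values on
  \<^const>\<open>schwartz\<close> are meaningful, and accordingly they are compared by \<open>dist_eq\<close>. The pairing is
  bilinear: a function \<open>f\<close> is the distribution \<open>\<phi> \<mapsto> \<integral> f \<phi>\<close>.
\<close>

definition tempered_distribution :: "((real \<Rightarrow> complex) \<Rightarrow> complex) \<Rightarrow> bool" where
  "tempered_distribution u \<longleftrightarrow>
     (\<forall>\<phi>\<in>schwartz. \<forall>\<psi>\<in>schwartz. \<forall>c. u (\<lambda>x. c * \<phi> x + \<psi> x) = c * u \<phi> + u \<psi>) \<and>
     (\<exists>C N. \<forall>\<phi>\<in>schwartz. norm (u \<phi>) \<le> C * (\<Sum>m\<le>N. \<Sum>n\<le>N. schwartz_seminorm m n \<phi>))"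

definition dist_eq :: "((real \<Rightarrow> complex) \<Rightarrow> complex) \<Rightarrow> ((real \<Rightarrow> complex) \<Rightarrow> complex) \<Rightarrow> bool" where
  "dist_eq u v \<longleftrightarrow> (\<forall>\<phi>\<in>schwartz. u \<phi> = v \<phi>)"

definition dist_of_fun :: "(real \<Rightarrow> complex) \<Rightarrow> (real \<Rightarrow> complex) \<Rightarrow> complex" where
  "dist_of_fun f \<phi> = (LINT x|lborel. f x * \<phi> x)"

definition dist_mult :: "(real \<Rightarrow> complex) \<Rightarrow> ((real \<Rightarrow> complex) \<Rightarrow> complex)
    \<Rightarrow> (real \<Rightarrow> complex) \<Rightarrow> complex" where
  "dist_mult g u \<phi> = u (\<lambda>x. g x * \<phi> x)"

text \<open>The distribution \<open>u(x - h)\<close>.\<close>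

definition dist_translate :: "real \<Rightarrow> ((real \<Rightarrow> complex) \<Rightarrow> complex) \<Rightarrow> (real \<Rightarrow> complex) \<Rightarrow> complex"
  where "dist_translate h u \<phi> = u (\<lambda>x. \<phi> (x + h))"

definition dirac_comb :: "real \<Rightarrow> (real \<Rightarrow> complex) \<Rightarrow> complex" where
  "dirac_comb r \<phi> = complex_of_real (sqrt r) * (\<Sum>\<^sub>\<infinity>k\<in>(UNIV :: int set). \<phi> (r * of_int k))"


section \<open>The fractional Fourier transform\<close>

definition frac_kernel :: "real \<Rightarrow> real \<Rightarrow> real \<Rightarrow> complex" where
  "frac_kernel \<alpha> x y =
     exp (pi * \<i> / sin (pi * \<alpha> / 2) * (cos (pi * \<alpha> / 2) * (x\<^sup>2 + y\<^sup>2) - 2 * x * y))"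

text \<open>The case \<open>-2 < \<alpha> < 2\<close>. For \<open>\<alpha> \<noteq> 0\<close> the radicand is a nonzero imaginary number, so its principal
  root \<^const>\<open>csqrt\<close> is the one with positive real part.\<close>

definition frac_fourier_base :: "real \<Rightarrow> (real \<Rightarrow> complex) \<Rightarrow> real \<Rightarrow> complex" where
  "frac_fourier_base \<alpha> f x =
     (if \<alpha> = 0 then f x
      else 1 / csqrt (\<i> * sin (pi * \<alpha> / 2)) * (LINT y|lborel. frac_kernel \<alpha> x y * f y))"

text \<open>Outside \<open>(-2,2)\<close> one particular \<open>k\<close> with \<open>\<alpha> - 2 * k \<in> (-2,2)\<close> is used; by \<open>frac_fourier_shift\<close>
  below, every other choice gives the same function.\<close>

definition frac_fourier :: "real \<Rightarrow> (real \<Rightarrow> complex) \<Rightarrow> real \<Rightarrow> complex" where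
  "frac_fourier \<alpha> f x =
     (if -2 < \<alpha> \<and> \<alpha> < 2 then frac_fourier_base \<alpha> f x
      else let k = \<lfloor>\<alpha> / 2\<rfloor> in
        exp (- (pi * \<i> / 2) * of_int k)
          * frac_fourier_base (\<alpha> - 2 * of_int k) f ((-1) powi k * x))"

text \<open>The weakly continuous extension to tempered distributions: since the kernel is symmetric, it
  is transposition with respect to the bilinear pairing. That it does extend \<^const>\<open>frac_fourier\<close> is
  \<open>dist_frac_fourier_dist_of_fun\<close> below.\<close>

definition dist_frac_fourier :: "real \<Rightarrow> ((real \<Rightarrow> complex) \<Rightarrow> complex)
    \<Rightarrow> (real \<Rightarrow> complex) \<Rightarrow> complex" where
  "dist_frac_fourier \<alpha> u \<phi> = u (frac_fourier \<alpha> \<phi>)"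


section \<open>Consistency of the definitions\<close>

lemma csqrt_uminus_imaginary:
  assumes "S < (0::real)"
  shows "csqrt (- (\<i> * S)) = \<i> * csqrt (\<i> * S)"
proof (rule csqrt_unique)
  show "(\<i> * csqrt (\<i> * S))\<^sup>2 = - (\<i> * S)"
    by (simp add: power_mult_distrib)
  have "Im (csqrt (\<i> * S)) < 0"
    using assms by (simp add: csqrt.simps norm_mult)
  then show "0 < Re (\<i> * csqrt (\<i> * S)) \<or> Re (\<i> * csqrt (\<i> * S)) = 0 \<and> 0 \<le> Im (\<i> * csqrt (\<i> * S))"
    by simp
qed

lemma frac_fourier_base_neg:
  assumes "-2 < \<alpha>" "\<alpha> < 0"
  shows "frac_fourier_base \<alpha> f x = \<i> * frac_fourier_base (\<alpha> + 2) f (- x)"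
proof -
  have eq: "pi * (\<alpha> + 2) / 2 = pi * \<alpha> / 2 + pi" by (simp add: field_simps)
  define S where "S = sin (pi * \<alpha> / 2)"
  have "pi * (- \<alpha>) / 2 > 0" "pi * (- \<alpha>) / 2 < pi"
    using assms mult_strict_left_mono[of "- \<alpha>" 2 pi] by (auto intro: mult_pos_neg)
  then have "sin (pi * (- \<alpha>) / 2) > 0" by (rule sin_gt_zero)
  then have S: "S < 0" by (simp add: S_def)
  have sc: "sin (pi * (\<alpha> + 2) / 2) = - S" "cos (pi * (\<alpha> + 2) / 2) = - cos (pi * \<alpha> / 2)"
    unfolding eq by (simp_all add: S_def)
  have "frac_kernel (\<alpha> + 2) (- x) y = frac_kernel \<alpha> x y" for y
    unfolding frac_kernel_def sc S_def[symmetric] using S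
    by (intro arg_cong[where f = exp]) (simp add: field_simps)
  moreover have "1 / csqrt (\<i> * S) = \<i> * (1 / csqrt (- (\<i> * S)))"
    unfolding csqrt_uminus_imaginary[OF S] by simp
  ultimately show ?thesis
    using assms unfolding frac_fourier_base_def sc S_def[symmetric] by simp
qed

lemma exp_half_pi_uminus: "exp (- (pi * \<i> / 2) * of_int (-1)) = \<i>"
  using cis_conv_exp[of "pi / 2"] by (simp add: mult_ac)

lemma frac_fourier_floor:
  "frac_fourier \<alpha> f x = exp (- (pi * \<i> / 2) * of_int \<lfloor>\<alpha> / 2\<rfloor>)
     * frac_fourier_base (\<alpha> - 2 * of_int \<lfloor>\<alpha> / 2\<rfloor>) f ((-1) powi \<lfloor>\<alpha> / 2\<rfloor> * x)"
proof (cases "-2 < \<alpha> \<and> \<alpha> < 2")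
  case True
  show ?thesis
  proof (cases "\<alpha> < 0")
    case neg: True
    then have "\<lfloor>\<alpha> / 2\<rfloor> = -1" using True by linarith
    then show ?thesis
      using True neg frac_fourier_base_neg[of \<alpha> f x] exp_half_pi_uminus
      by (simp add: frac_fourier_def)
  next
    case False
    then have "\<lfloor>\<alpha> / 2\<rfloor> = 0" using True by linarith
    then show ?thesis using True by (simp add: frac_fourier_def)
  qed
qed (simp only: frac_fourier_def Let_def if_False)

lemma frac_fourier_shift:
  "frac_fourier (\<alpha> + 2 * of_int k) f x
     = exp (- (pi * \<i> / 2) * of_int k) * frac_fourier \<alpha> f ((-1) powi k * x)"
proof -
  have fl: "\<lfloor>(\<alpha> + 2 * of_int k) / 2\<rfloor> = \<lfloor>\<alpha> / 2\<rfloor> + k"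
    by (simp add: add_divide_distrib)
  have "exp (- (pi * \<i> / 2) * of_int (\<lfloor>\<alpha> / 2\<rfloor> + k))
      = exp (- (pi * \<i> / 2) * of_int k) * exp (- (pi * \<i> / 2) * of_int \<lfloor>\<alpha> / 2\<rfloor>)"
    unfolding exp_add[symmetric] by (simp add: algebra_simps)
  moreover have "\<alpha> + 2 * of_int k - 2 * of_int (\<lfloor>\<alpha> / 2\<rfloor> + k) = \<alpha> - 2 * of_int \<lfloor>\<alpha> / 2\<rfloor>"
    by simp
  moreover have "(-1) powi (\<lfloor>\<alpha> / 2\<rfloor> + k) * x = (-1) powi \<lfloor>\<alpha> / 2\<rfloor> * ((-1) powi k * x)"
    by (simp add: power_int_add)
  ultimately show ?thesis
    by (simp only: frac_fourier_floor[of "\<alpha> + 2 * of_int k"] frac_fourier_floor[of \<alpha>] fl mult.assoc)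
qed

lemma frac_fourier_two: "frac_fourier 2 f x = - \<i> * f (- x)"
  using frac_fourier_shift[of 0 1 f x] cis_conv_exp[of "- (pi / 2)"]
  by (simp add: frac_fourier_def frac_fourier_base_def mult_ac)

lemma schwartz_continuous:
  assumes "f \<in> schwartz" shows "continuous_on UNIV f"
proof -
  have "nth_deriv 0 f differentiable (at x)" for x
    using assms by (auto simp: schwartz_def)
  then show ?thesis
    by (simp add: nth_deriv_def continuous_on_eq_continuous_at differentiable_imp_continuous_within)
qed

lemma schwartz_seminorm_bound:
  assumes "f \<in> schwartz"
  shows "norm (x ^ m *\<^sub>R nth_deriv n f x) \<le> schwartz_seminorm m n f"
proof -
  have "bounded (range (\<lambda>x. x ^ m *\<^sub>R nth_deriv n f x))"
    using assms by (auto simp: schwartz_def)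
  then have "bdd_above (range (\<lambda>x. norm (x ^ m *\<^sub>R nth_deriv n f x)))"
    by (force simp: bounded_iff bdd_above_def)
  then show ?thesis
    unfolding schwartz_seminorm_def by (rule cSUP_upper[rotated]) simp
qed

lemma schwartz_decay:
  assumes "f \<in> schwartz"
  shows "norm (f x) \<le> (schwartz_seminorm 0 0 f + schwartz_seminorm 2 0 f) * inverse (1 + x\<^sup>2)"
proof -
  have "norm (f x) * (1 + x\<^sup>2) \<le> schwartz_seminorm 0 0 f + schwartz_seminorm 2 0 f"
    using schwartz_seminorm_bound[OF assms, of x 0 0] schwartz_seminorm_bound[OF assms, of x 2 0]
    by (simp add: nth_deriv_def algebra_simps)
  moreover have "1 + x\<^sup>2 > 0" by (simp add: add_pos_nonneg)
  ultimately show ?thesis by (simp add: field_simps)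
qed

lemma integrable_schwartz:
  assumes "f \<in> schwartz" shows "integrable lborel f"
proof (rule Bochner_Integration.integrable_bound)
  let ?C = "schwartz_seminorm 0 0 f + schwartz_seminorm 2 0 f"
  have "integrable lborel (\<lambda>x::real. inverse (1 + x\<^sup>2))"
    using integrable_inverse_1_plus_square by (simp add: set_integrable_def einterval_def)
  then show "integrable lborel (\<lambda>x. ?C * inverse (1 + x\<^sup>2))" by simp
  show "f \<in> borel_measurable lborel"
    using borel_measurable_continuous_onI[OF schwartz_continuous[OF assms]] by simp
  show "AE x in lborel. norm (f x) \<le> norm (?C * inverse (1 + x\<^sup>2))"
    using schwartz_decay[OF assms] by (intro AE_I2 order_trans[OF schwartz_decay[OF assms]]) simp
qed

lemma norm_frac_kernel: "norm (frac_kernel \<alpha> x y) = 1"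
proof -
  have "pi * \<i> / sin (pi * \<alpha> / 2) * (cos (pi * \<alpha> / 2) * (x\<^sup>2 + y\<^sup>2) - 2 * x * y)
      = \<i> * of_real (pi / sin (pi * \<alpha> / 2) * (cos (pi * \<alpha> / 2) * (x\<^sup>2 + y\<^sup>2) - 2 * x * y))"
    by simp
  then show ?thesis unfolding frac_kernel_def by (simp only: norm_exp_i_times)
qed

lemma frac_kernel_commute: "frac_kernel \<alpha> x y = frac_kernel \<alpha> y x"
  by (simp add: frac_kernel_def add.commute mult_ac)

lemma frac_kernel_measurable [measurable]:
  "(\<lambda>z. frac_kernel \<alpha> (fst z) (snd z)) \<in> borel_measurable (borel \<Otimes>\<^sub>M borel)"
  unfolding frac_kernel_def by measurable

lemma frac_fourier_base_dual:
  assumes f: "integrable lborel f" and g: "integrable lborel g"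
  shows "(LINT x|lborel. f x * frac_fourier_base \<alpha> g x)
       = (LINT x|lborel. frac_fourier_base \<alpha> f x * g x)"
proof (cases "\<alpha> = 0")
  case False
  define F where "F = (\<lambda>x y. f x * frac_kernel \<alpha> x y * g y)"
  have [measurable]: "f \<in> borel_measurable borel" "g \<in> borel_measurable borel"
    using f g by auto
  have nF: "norm (F x y) = norm (f x) * norm (g y)" for x y
    by (simp add: F_def norm_mult norm_frac_kernel)
  have "integrable (lborel \<Otimes>\<^sub>M lborel) (case_prod F)"
  proof (rule lborel_pair.Fubini_integrable)
    show meas: "case_prod F \<in> borel_measurable (lborel \<Otimes>\<^sub>M lborel)"
      unfolding F_def case_prod_beta by measurable
    show "integrable lborel (\<lambda>x. \<integral>y. norm (case_prod F (x, y)) \<partial>lborel)"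
      using f by (simp add: nF)
    have "integrable lborel (\<lambda>y. F x y)" for x
    proof (rule Bochner_Integration.integrable_bound)
      show "integrable lborel (\<lambda>y. norm (f x) * norm (g y))" using g by simp
      have "(\<lambda>y. case_prod F (x, y)) \<in> borel_measurable lborel" using meas by measurable
      then show "F x \<in> borel_measurable lborel" by simp
    qed (simp add: nF)
    then show "AE x in lborel. integrable lborel (\<lambda>y. case_prod F (x, y))" by simp
  qed
  then have *: "(LINT y|lborel. LINT x|lborel. F x y) = (LINT x|lborel. LINT y|lborel. F x y)"
    by (rule lborel_pair.Fubini_integral)
  have "(LINT x|lborel. LINT y|lborel. F x y)
      = (LINT x|lborel. f x * (LINT y|lborel. frac_kernel \<alpha> x y * g y))"
    by (simp add: F_def mult.assoc)
  moreover have "(LINT y|lborel. LINT x|lborel. F x y)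
      = (LINT y|lborel. (LINT x|lborel. frac_kernel \<alpha> y x * f x) * g y)"
    by (simp add: F_def frac_kernel_commute[of \<alpha>] mult.commute[of "f _"])
  ultimately show ?thesis
    using False * by (simp add: frac_fourier_base_def mult.left_commute)
qed (simp add: frac_fourier_base_def)

lemma integral_reflect:
  fixes f :: "real \<Rightarrow> complex"
  shows "(LINT x|lborel. f (- x)) = (LINT x|lborel. f x)"
  using lborel_integral_real_affine[of "-1" f 0] by simp

lemma frac_fourier_base_reflect:
  "frac_fourier_base \<alpha> (\<lambda>x. f (- x)) x = frac_fourier_base \<alpha> f (- x)"
proof -
  have "(LINT y|lborel. frac_kernel \<alpha> x y * f (- y)) = (LINT y|lborel. frac_kernel \<alpha> (- x) y * f y)"
    using integral_reflect[of "\<lambda>y. frac_kernel \<alpha> (- x) y * f y"] by (simp add: frac_kernel_def)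
  then show ?thesis by (simp add: frac_fourier_base_def)
qed

lemma dist_frac_fourier_dist_of_fun:
  assumes "f \<in> schwartz"
  shows "dist_eq (dist_frac_fourier \<alpha> (dist_of_fun f)) (dist_of_fun (frac_fourier \<alpha> f))"
  unfolding dist_eq_def dist_frac_fourier_def dist_of_fun_def
proof
  fix g assume "g \<in> schwartz"
  then have g: "integrable lborel g" by (rule integrable_schwartz)
  have f: "integrable lborel f" using assms by (rule integrable_schwartz)
  then have f': "integrable lborel (\<lambda>x. f (- x))"
    using lborel_integrable_real_affine[of f "-1" 0] by simp
  define k where "k = \<lfloor>\<alpha> / 2\<rfloor>"
  define B where "B = frac_fourier_base (\<alpha> - 2 * of_int k)"
  have "(LINT x|lborel. f x * B g ((-1) powi k * x)) = (LINT x|lborel. B f ((-1) powi k * x) * g x)"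
  proof (cases "even k")
    case True
    then show ?thesis using frac_fourier_base_dual[OF f g] by (simp add: B_def power_int_minus_left)
  next
    case False
    have "(LINT x|lborel. f x * B g (- x)) = (LINT x|lborel. f (- x) * B g x)"
      using integral_reflect[of "\<lambda>x. f (- x) * B g x"] by simp
    also have "\<dots> = (LINT x|lborel. B f (- x) * g x)"
      using frac_fourier_base_dual[OF f' g] by (simp add: B_def frac_fourier_base_reflect)
    finally show ?thesis using False by (simp add: power_int_minus_left)
  qed
  then have "c * (LINT x|lborel. f x * B g ((-1) powi k * x))
      = c * (LINT x|lborel. B f ((-1) powi k * x) * g x)" for c by simp
  then show "(LINT x|lborel. f x * frac_fourier \<alpha> g x) = (LINT x|lborel. frac_fourier \<alpha> f x * g x)"
    unfolding frac_fourier_floor k_def[symmetric] B_def[symmetric]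
    by (simp only: mult.assoc mult.left_commute[of "f _" "exp _"] integral_mult_right_zero)
qed

lemma dirac_comb_summable_aux:
  assumes "r > (0::real)"
  shows "(\<lambda>k::int. inverse (1 + (r * of_int k)\<^sup>2)) summable_on UNIV"
proof -
  have nat: "(\<lambda>n::nat. inverse (1 + (r * real n)\<^sup>2)) summable_on UNIV"
  proof (rule norm_summable_imp_summable_on, rule summable_comparison_test)
    show "summable (\<lambda>n. inverse (r\<^sup>2) * inverse ((real n)\<^sup>2))"
      by (intro summable_mult inverse_power_summable) simp
    have "norm (norm (inverse (1 + (r * real n)\<^sup>2))) \<le> inverse (r\<^sup>2) * inverse ((real n)\<^sup>2)"
      if "n \<ge> 1" for n
    proof -
      have "inverse (1 + (r * real n)\<^sup>2) \<le> inverse ((r * real n)\<^sup>2)"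
        using assms that by (intro le_imp_inverse_le) auto
      then show ?thesis by (simp add: power_mult_distrib)
    qed
    then show "\<exists>N. \<forall>n\<ge>N. norm (norm (inverse (1 + (r * real n)\<^sup>2))) \<le> inverse (r\<^sup>2) * inverse ((real n)\<^sup>2)"
      by blast
  qed
  have "(\<lambda>k::int. inverse (1 + (r * of_int k)\<^sup>2)) summable_on range int"
    using nat by (subst summable_on_reindex) (auto simp: o_def)
  moreover have "(\<lambda>k::int. inverse (1 + (r * of_int k)\<^sup>2)) summable_on range (\<lambda>n. - int n)"
    using nat by (subst summable_on_reindex) (auto simp: o_def inj_on_def)
  ultimately have "(\<lambda>k::int. inverse (1 + (r * of_int k)\<^sup>2)) summable_on (range int \<union> range (\<lambda>n. - int n))"
    by (rule summable_on_union)
  moreover have "range int \<union> range (\<lambda>n. - int n) = UNIV"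
    by (auto simp: image_iff) (metis int_cases2)
  ultimately show ?thesis by simp
qed

lemma tempered_dirac_comb:
  assumes "r > 0"
  shows "tempered_distribution (dirac_comb r)"
proof -
  define w where "w = (\<lambda>k::int. inverse (1 + (r * of_int k)\<^sup>2))"
  have w: "w summable_on UNIV" unfolding w_def by (rule dirac_comb_summable_aux[OF assms])
  define q where "q = (\<lambda>\<phi>. schwartz_seminorm 0 0 \<phi> + schwartz_seminorm 2 0 \<phi>)"
  have decay: "norm (\<phi> (r * of_int k)) \<le> q \<phi> * w k" if "\<phi> \<in> schwartz" for \<phi> k
    using schwartz_decay[OF that, of "r * of_int k"] by (simp add: q_def w_def)
  have qw: "(\<lambda>k. q \<phi> * w k) summable_on UNIV" for \<phi> by (intro summable_on_cmult_right w)
  have abs: "(\<lambda>k::int. norm (\<phi> (r * of_int k))) summable_on UNIV" if "\<phi> \<in> schwartz" for \<phi>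
    by (rule summable_on_comparison_test[OF qw]) (use decay[OF that] in auto)
  have summ: "(\<lambda>k::int. \<phi> (r * of_int k)) summable_on UNIV" if "\<phi> \<in> schwartz" for \<phi>
    using abs[OF that] by (rule abs_summable_summable)
  have lin: "dirac_comb r (\<lambda>x. c * \<phi> x + \<psi> x) = c * dirac_comb r \<phi> + dirac_comb r \<psi>"
    if "\<phi> \<in> schwartz" "\<psi> \<in> schwartz" for \<phi> \<psi> c
    unfolding dirac_comb_def using summ[OF that(1)] summ[OF that(2)]
    by (simp add: infsum_add summable_on_cmult_right infsum_cmult_right algebra_simps)
  define C where "C = sqrt r * infsum w UNIV"
  have w0: "infsum w UNIV \<ge> 0" by (rule infsum_nonneg) (simp add: w_def)
  have bd: "norm (dirac_comb r \<phi>) \<le> C * (\<Sum>m\<le>2. \<Sum>n\<le>2. schwartz_seminorm m n \<phi>)"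
    if \<phi>: "\<phi> \<in> schwartz" for \<phi>
  proof -
    have p: "schwartz_seminorm m n \<phi> \<ge> 0" for m n
      using schwartz_seminorm_bound[OF \<phi>, of 0 m n] norm_ge_zero order_trans by blast
    have "norm (\<Sum>\<^sub>\<infinity>k\<in>(UNIV::int set). \<phi> (r * of_int k)) \<le> (\<Sum>\<^sub>\<infinity>k\<in>(UNIV::int set). norm (\<phi> (r * of_int k)))"
      using abs[OF \<phi>] by (rule norm_infsum_bound)
    also have "\<dots> \<le> (\<Sum>\<^sub>\<infinity>k\<in>UNIV. q \<phi> * w k)"
      by (rule infsum_mono[OF abs[OF \<phi>] qw]) (rule decay[OF \<phi>])
    also have "\<dots> = q \<phi> * infsum w UNIV" by (simp add: infsum_cmult_right w)
    finally have "norm (dirac_comb r \<phi>) \<le> C * q \<phi>"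
      using assms by (simp add: dirac_comb_def norm_mult C_def mult_left_mono mult_ac)
    also have "q \<phi> \<le> (\<Sum>m\<le>2. \<Sum>n\<le>2. schwartz_seminorm m n \<phi>)"
      using p by (simp add: q_def numeral_2_eq_2 add_nonneg_nonneg)
    then have "C * q \<phi> \<le> C * (\<Sum>m\<le>2. \<Sum>n\<le>2. schwartz_seminorm m n \<phi>)"
      using w0 assms by (intro mult_left_mono) (simp_all add: C_def)
    finally show ?thesis .
  qed
  show ?thesis unfolding tempered_distribution_def using lin bd by blast
qed

end

theory Submission
  imports Defs "HOL-Probability.Characteristic_Functions" "HOL-Complex_Analysis.Conformal_Mappings"
begin

text \<open>
  Both claims follow from evaluating the given identity at a single test function, the Gaussian
  \<open>\<phi>(x) = exp(-\<pi> x\<^sup>2)\<close>. It is an eigenfunction of every fractional Fourier transform,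
  \<open>F\<^sup>\<alpha> \<phi> = e\<^bsup>-\<pi> i \<alpha> / 4\<^esup> \<phi>\<close>, so with \<open>\<tau> = i r\<^sup>2\<close> both sides become theta series:

  \<open>\<surd>(r s) e\<^bsup>-\<pi> i \<alpha> / 4\<^esup> \<theta>\<^bsub>0,0\<^esub>(\<tau>) = \<mu>\<^sub>0 \<theta>\<^bsub>ab,-cd\<^esub>(\<gamma>\<tau>)\<close> with \<open>\<gamma>\<tau> = (d \<tau> - c) / (a - b \<tau>)\<close>,

  where \<open>\<theta>\<^bsub>m,n\<^esub>(\<tau>)\<close> is the sum of \<open>exp(\<pi> i \<tau> (k + m/2)\<^sup>2 + \<pi> i n (k + m/2))\<close> over all integers \<open>k\<close>
  (\<open>dirac_comb_identity_at_gaussian\<close>). The hypothesis on \<open>e\<^bsup>\<pi> i \<alpha> / 2\<^esup>\<close> says precisely that the square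
  of the factor \<open>\<surd>(r s) e\<^bsup>-\<pi> i \<alpha> / 4\<^esup>\<close> is \<open>a - b \<tau>\<close>.

  The eighth power of \<open>\<theta>\<close> transforms without any root of unity: its characteristics \<open>m, n\<close> only
  matter modulo 2, the translation \<open>\<tau> + 1\<close> replaces \<open>n\<close> by \<open>n + m + 1\<close>, and, by Poisson summation,
  the inversion \<open>-1/\<tau>\<close> exchanges \<open>m\<close> and \<open>n\<close> and produces the factor \<open>\<tau>\<^sup>4\<close>. The Euclidean algorithm
  on the matrix entries combines these two moves to

  \<open>\<theta>\<^bsub>ab,-cd\<^esub>(\<gamma>\<tau>)\<^sup>8 = (a - b \<tau>)\<^sup>4 \<theta>\<^bsub>0,0\<^esub>(\<tau>)\<^sup>8\<close>

  (\<open>theta_transform_SL2\<close>). Since \<open>\<theta>\<^bsub>0,0\<^esub>(i r\<^sup>2)\<close> is a sum of positive numbers, comparing the two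
  displays gives \<open>\<mu>\<^sub>0\<^sup>8 = 1\<close>.

  For the dependence of \<open>\<mu>\<^sub>0\<close> on the data, \<open>\<surd>(r s) e\<^bsup>-\<pi> i \<alpha> / 4\<^esup>\<close> is the complex conjugate of the
  principal root of \<open>a + i b r\<^sup>2\<close> up to a sign, and that sign says whether \<open>\<alpha>\<close> is congruent modulo 8
  to an element of \<open>(-2,2]\<close> (\<open>csqrt_of_square_cis\<close>). Hence \<open>\<mu>\<^sub>0\<close> is this sign times an expression in
  \<open>a, b, c, d\<close> and \<open>r\<close> which is continuous in \<open>r > 0\<close> and takes values in the finite set of eighth
  roots of unity; it does not depend on \<open>r\<close> (\<open>theta_multiplier_constant\<close>).

  Poisson summation is proved for Gaussians with complex parameter. Both sides are even and periodic
  and have the same Fourier coefficients, and Weierstrass approximation shows that such a function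
  is determined by its coefficients.
\<close>

section \<open>Fourier transform of a Gaussian with complex parameter\<close>

text \<open>
  One family serves three purposes: the test function has \<open>z = 1\<close> and \<open>\<xi> = 0\<close>, the integrands of its
  fractional Fourier transforms have \<open>Re z = 1\<close>, and the terms of a theta series at \<open>\<tau>\<close> have
  \<open>z = -i \<tau>\<close>.
\<close>

definition gaussian_wave :: "complex \<Rightarrow> real \<Rightarrow> real \<Rightarrow> complex" where
  "gaussian_wave z \<xi> y = exp (- complex_of_real pi * z * (complex_of_real y)\<^sup>2 + 2 * pi * \<i> * \<xi> * y)"

lemma gaussian_wave_measurable [measurable]: "gaussian_wave z \<xi> \<in> borel_measurable borel"
  unfolding gaussian_wave_def by measurable

lemma norm_gaussian_wave:
  fixes z :: complex and \<xi> y :: real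
  shows "norm (gaussian_wave z \<xi> y) = exp (- pi * Re z * y\<^sup>2)"
  by (simp add: gaussian_wave_def norm_exp_eq_Re power2_eq_square)

lemma integrable_real_gaussian:
  fixes p :: real assumes "p > 0"
  shows "integrable lborel (\<lambda>y::real. exp (- pi * p * y\<^sup>2))"
proof -
  have "integrable lborel (\<lambda>y. sqrt (1/p) * normal_density 0 (1 / sqrt (2 * pi * p)) y)"
    by (intro integrable_mult_right integrable_normal_density) (use assms in simp)
  also have "(\<lambda>y. sqrt (1/p) * normal_density 0 (1 / sqrt (2 * pi * p)) y) = (\<lambda>y::real. exp (- pi * p * y\<^sup>2))"
    using assms by (simp add: fun_eq_iff normal_density_def power_divide real_sqrt_divide)
  finally show ?thesis .
qed

lemma integrable_gaussian_wave:
  fixes z :: complex and \<xi> :: real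
  assumes "Re z > 0"
  shows "integrable lborel (gaussian_wave z \<xi>)"
proof (rule Bochner_Integration.integrable_bound[OF integrable_real_gaussian[OF assms]])
  show "AE y in lborel. norm (gaussian_wave z \<xi> y) \<le> norm (exp (- pi * Re z * y\<^sup>2))"
    by (simp add: norm_gaussian_wave)
qed simp

text \<open>
  After rescaling, this is the characteristic function of the standard normal distribution.
\<close>

lemma fourier_gaussian_real:
  fixes p \<xi> :: real
  assumes "p > 0"
  shows "(LINT y|lborel. gaussian_wave p \<xi> y)
    = exp (- pi * \<xi>\<^sup>2 / p) / sqrt p"
proof -
  define \<sigma> where "\<sigma> = sqrt (2 * pi * p)"
  have \<sigma>: "\<sigma> > 0" "\<sigma>\<^sup>2 = 2 * pi * p" using assms by (auto simp: \<sigma>_def)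
  define t where "t = 2 * pi * \<xi> / \<sigma>"
  have "complex_of_real (exp (- t\<^sup>2 / 2)) = (LINT x|density lborel std_normal_density. exp (\<i> * (t * x)))"
    using fun_cong[OF char_std_normal_distribution, of t] by (simp add: char_def)
  also have "\<dots> = (LINT x|lborel. std_normal_density x *\<^sub>R exp (\<i> * (t * x)))"
    by (subst integral_density) auto
  also have "\<dots> = \<bar>\<sigma>\<bar> *\<^sub>R (LINT y|lborel. std_normal_density (0 + \<sigma> * y) *\<^sub>R exp (\<i> * (t * complex_of_real (0
      + \<sigma> * y))))"
    using \<sigma> by (subst lborel_integral_real_affine[of \<sigma> _ 0]) auto
  also have "(\<lambda>y. std_normal_density (0 + \<sigma> * y) *\<^sub>R exp (\<i> * (t * complex_of_real (0 + \<sigma> * y)))) =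
    (\<lambda>y. complex_of_real (1 / sqrt (2 * pi)) * gaussian_wave p \<xi> y)"
  proof
    fix y
    have "complex_of_real (exp (- (pi * p * y\<^sup>2))) = exp (- pi * complex_of_real p * (complex_of_real y)\<^sup>2)"
      by (simp flip: exp_of_real)
    then show "std_normal_density (0 + \<sigma> * y) *\<^sub>R exp (\<i> * (t * complex_of_real (0 + \<sigma> * y))) =
       complex_of_real (1 / sqrt (2 * pi)) * gaussian_wave p \<xi> y"
      using \<sigma> by (simp add: gaussian_wave_def std_normal_density_def power_mult_distrib t_def
          scaleR_conv_of_real mult_ac
          flip: exp_add)
  qed
  finally have "complex_of_real (exp (- t\<^sup>2 / 2)) = complex_of_real (\<sigma> / sqrt (2 * pi)) *
     (LINT y|lborel. gaussian_wave p \<xi> y)"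
    using \<sigma> by (simp add: scaleR_conv_of_real)
  moreover have "\<sigma> / sqrt (2 * pi) = sqrt p" by (simp add: \<sigma>_def real_sqrt_mult)
  moreover have "- t\<^sup>2 / 2 = - pi * \<xi>\<^sup>2 / p"
    using assms by (simp add: t_def power_divide power_mult_distrib \<sigma>) (simp add: field_simps
        power2_eq_square)
  ultimately have "complex_of_real (exp (- pi * \<xi>\<^sup>2 / p)) = sqrt p * (LINT y|lborel. gaussian_wave p \<xi> y)"
      by simp
  then show ?thesis using assms by (simp add: field_simps)
qed

text \<open>
  The integrals over \<open>[-n,n]\<close> are holomorphic in \<open>z\<close>, and on a disc in the half-plane they converge
  uniformly, because the tails are dominated by those of a single real Gaussian.
\<close>

lemma fourier_gaussian_holomorphic:
  fixes \<xi> :: real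
  shows "(\<lambda>z. LINT y|lborel. gaussian_wave z \<xi> y) holomorphic_on {z::complex. Re z > 0}"
proof (rule holomorphic_uniform_sequence)
  let ?e = "\<lambda>z. gaussian_wave z \<xi>"
  let ?f = "\<lambda>n z. integral (cbox (- real n) (real n)) (?e z)"
  show "open {z::complex. Re z > 0}" by (rule open_halfspace_Re_gt)
  show "?f n holomorphic_on {z::complex. Re z > 0}" for n
  proof (rule leibniz_rule_holomorphic)
    show "((\<lambda>z. ?e z y) has_field_derivative - pi * y\<^sup>2 * ?e z y) (at z within {z::complex. Re z > 0})" for
        z and y :: real
      unfolding gaussian_wave_def by (auto intro!: derivative_eq_intros)
    show "?e z integrable_on cbox (- real n) (real n)" for z
      unfolding gaussian_wave_def by (intro integrable_continuous continuous_intros)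
    show "continuous_on ({z. 0 < Re z} \<times> cbox (- real n) (real n)) (\<lambda>(z, y). - pi * y\<^sup>2 * ?e z y)"
      unfolding gaussian_wave_def by (auto simp: case_prod_beta intro!: continuous_intros)
    show "convex {z::complex. Re z > 0}" by (rule convex_halfspace_Re_gt)
  qed
  fix z0 :: complex assume "z0 \<in> {z::complex. Re z > 0}"
  then have z0: "Re z0 > 0" by simp
  define p where "p = Re z0 / 2"
  have p: "p > 0" using z0 by (simp add: p_def)
  have Re: "Re z \<ge> p" if "z \<in> cball z0 p" for z
    using that abs_Re_le_cmod[of "z0 - z"] by (simp add: p_def dist_norm)
  define R where "R = (\<lambda>n::nat. LINT y|lborel. indicator (- {- real n..real n}) y * exp (- pi * p * y\<^sup>2))"
  have bound: "norm (?f n z - (LINT y|lborel. ?e z y)) \<le> R n" if z: "z \<in> cball z0 p" for n z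
  proof -
    have int: "integrable lborel (?e z)" using Re[OF z] p by (intro integrable_gaussian_wave) simp
    have si: "set_integrable lborel {- real n..real n} (?e z)"
      unfolding set_integrable_def by (rule integrable_mult_indicator[OF _ int]) simp
    then have f: "?f n z = (LINT y|lborel. indicator {- real n..real n} y *\<^sub>R ?e z y)"
      using set_borel_integral_eq_integral(2)[OF si] by (simp add: set_lebesgue_integral_def)
    have i1: "integrable lborel (\<lambda>y. indicator {- real n..real n} y *\<^sub>R ?e z y)"
      using si by (simp add: set_integrable_def)
    have "norm (?f n z - (LINT y|lborel. ?e z y))
       = norm (LINT y|lborel. indicator {- real n..real n} y *\<^sub>R ?e z y - ?e z y)"
      unfolding f using i1 int by simp
    also have "\<dots> \<le> (LINT y|lborel. norm (indicator {- real n..real n} y *\<^sub>R ?e z y - ?e z y))"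
      by (rule integral_norm_bound)
    also have "\<dots> \<le> R n"
      unfolding R_def
    proof (rule integral_mono)
      show "integrable lborel (\<lambda>y. norm (indicator {- real n..real n} y *\<^sub>R ?e z y - ?e z y))"
        using i1 int by (intro integrable_norm Bochner_Integration.integrable_diff)
      show "integrable lborel (\<lambda>y. indicator (- {- real n..real n}) y * exp (- pi * p * y\<^sup>2))"
        using integrable_mult_indicator[OF _ integrable_real_gaussian[OF p], of "- {- real n..real n}"]
            by simp
      show "norm (indicator {- real n..real n} y *\<^sub>R ?e z y - ?e z y)
          \<le> indicator (- {- real n..real n}) y * exp (- pi * p * y\<^sup>2)" for y
      proof -
        have "norm (?e z y) \<le> exp (- pi * p * y\<^sup>2)"
          unfolding norm_gaussian_wave using Re[OF z] by (simp add: mult_right_mono)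
        then show ?thesis by (simp split: split_indicator)
      qed
    qed
    finally show ?thesis .
  qed
  have "R \<longlonglongrightarrow> (LINT y::real|lborel. 0::real)"
    unfolding R_def
  proof (rule integral_dominated_convergence[where w = "\<lambda>y. exp (- pi * p * y\<^sup>2)"])
    show "integrable lborel (\<lambda>y. exp (- pi * p * y\<^sup>2))" by (rule integrable_real_gaussian[OF p])
    have "(\<lambda>n. indicator (- {- real n..real n}) y * exp (- pi * p * y\<^sup>2)) \<longlonglongrightarrow> 0" for y
    proof (rule tendsto_eventually)
      show "\<forall>\<^sub>F n in sequentially. indicator (- {- real n..real n}) y * exp (- pi * p * y\<^sup>2) = 0"
        using eventually_ge_at_top[of "nat \<lceil>\<bar>y\<bar>\<rceil>"]
      proof eventually_elim
        case (elim n)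
        then have "\<bar>y\<bar> \<le> real n" by linarith
        then show ?case by (simp add: indicator_def abs_le_iff)
      qed
    qed
    then show "AE y in lborel. (\<lambda>n. indicator (- {- real n..real n}) y * exp (- pi * p * y\<^sup>2)) \<longlonglongrightarrow> 0" by simp
  qed (auto split: split_indicator)
  then have R: "R \<longlonglongrightarrow> 0" by simp
  have "uniform_limit (cball z0 p) ?f (\<lambda>z. LINT y|lborel. ?e z y) sequentially"
  proof (rule uniform_limitI)
    fix e :: real assume "e > 0"
    then have "\<forall>\<^sub>F n in sequentially. R n < e" using R by (simp add: order_tendstoD)
    then show "\<forall>\<^sub>F n in sequentially. \<forall>z\<in>cball z0 p. dist (?f n z) (LINT y|lborel. ?e z y) < e"
    proof eventually_elim
      case (elim n)
      show ?case
      proof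
        fix z assume "z \<in> cball z0 p"
        from bound[OF this, of n] elim show "dist (?f n z) (LINT y|lborel. ?e z y) < e"
          unfolding dist_norm by (rule le_less_trans)
      qed
    qed
  qed
  moreover have "cball z0 p \<subseteq> {z::complex. Re z > 0}" using Re p by force
  ultimately show "\<exists>d>0. cball z0 d \<subseteq> {z::complex. Re z > 0} \<and> uniform_limit (cball z0 d) ?f (\<lambda>z. LINT
      y|lborel. ?e z y) sequentially"
    using p by blast
qed

text \<open>
  Both sides are holomorphic on the right half-plane and agree on the positive real axis.
\<close>

lemma fourier_gaussian:
  fixes z :: complex and \<xi> :: real
  assumes "Re z > 0"
  shows "(LINT y|lborel. gaussian_wave z \<xi> y) = exp (- pi * \<xi>\<^sup>2 / z) / csqrt z"
proof -
  define D where "D = (\<lambda>z::complex. (LINT y|lborel. gaussian_wave z \<xi> y) - exp (- pi * \<xi>\<^sup>2 / z) / csqrt z)"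
  have "D z = 0"
  proof (rule analytic_continuation[of D "{z::complex. Re z > 0}" "complex_of_real ` {0<..}" 1])
    show "D holomorphic_on {z::complex. Re z > 0}"
      unfolding D_def
    proof (intro holomorphic_on_diff fourier_gaussian_holomorphic holomorphic_on_divide)
      show "(\<lambda>z. exp (- pi * \<xi>\<^sup>2 / z)) holomorphic_on {z::complex. Re z > 0}"
        by (intro holomorphic_intros) auto
      show "csqrt holomorphic_on {z::complex. Re z > 0}"
        by (rule holomorphic_on_subset[OF holomorphic_on_csqrt]) (auto simp: complex_nonpos_Reals_iff)
    qed auto
    show "open {z::complex. Re z > 0}" by (rule open_halfspace_Re_gt)
    show "connected {z::complex. Re z > 0}" by (intro convex_connected convex_halfspace_Re_gt)
    have "(1::real) islimpt {0<..}" by (rule interior_limit_point) (simp add: interior_open)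
    then have "complex_of_real 1 islimpt complex_of_real ` {0<..}"
      by (rule islimpt_isCont_image) (auto simp: eventually_at_filter)
    then show "1 islimpt complex_of_real ` {0<..}" by simp
    show "D w = 0" if "w \<in> complex_of_real ` {0<..}" for w
      using that fourier_gaussian_real[of _ \<xi>]
          by (auto simp: D_def of_real_sqrt[symmetric] simp flip: exp_of_real)
  qed (use assms in auto)
  then show ?thesis by (simp add: D_def)
qed

section \<open>Even periodic functions are determined by their Fourier coefficients\<close>

text \<open>
  On the circle, an even function is a continuous function \<open>U\<close> of \<open>cos (2 \<pi> x)\<close>. Approximating \<open>U\<close>
  by polynomials, against which \<open>u\<close> integrates to zero, gives \<open>\<integral> u\<^sup>2 = 0\<close>.
\<close>

lemma even_periodic_zero_if_cos_moments_zero: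
  fixes u :: "real \<Rightarrow> real"
  assumes cont: "continuous_on {0..1} u"
    and sym: "\<And>x. x \<in> {0..1} \<Longrightarrow> u (1 - x) = u x"
    and mom: "\<And>m. integral {0..1} (\<lambda>x. u x * cos (2 * pi * x) ^ m) = 0"
    and x: "x \<in> {0..1}"
  shows "u x = 0"
proof -
  define U where "U = (\<lambda>y. u (arccos y / (2 * pi)))"
  have "continuous_on {-1..1} (\<lambda>y. arccos y / (2 * pi))"
    by (intro continuous_intros) auto
  moreover have "(\<lambda>y. arccos y / (2 * pi)) ` {-1..1} \<subseteq> {0..1}"
  proof (rule image_subsetI)
    fix y :: real assume "y \<in> {-1..1}"
    then have "0 \<le> arccos y" "arccos y \<le> pi" using arccos_lbound arccos_ubound by auto
    then show "arccos y / (2 * pi) \<in> {0..1}" using pi_gt_zero by (simp add: field_simps)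
  qed
  ultimately have U: "continuous_on {-1..1} U"
    unfolding U_def using continuous_on_compose2[OF cont] by blast
  \<comment> \<open>\<open>arccos\<close> recovers \<open>x\<close> on the first half of the period and \<open>1 - x\<close> on the second, where symmetry helps.\<close>
  have Uu: "U (cos (2 * pi * x)) = u x" if x: "x \<in> {0..1}" for x
  proof (cases "x \<le> 1/2")
    case True
    then have "arccos (cos (2 * pi * x)) = 2 * pi * x" using x by (intro arccos_cos) (auto simp: field_simps)
    then show ?thesis by (simp add: U_def)
  next
    case False
    have "cos (2 * pi * x) = cos (2 * pi * (1 - x))"
      by (simp add: right_diff_distrib cos_diff)
    moreover have "arccos (cos (2 * pi * (1 - x))) = 2 * pi * (1 - x)"
      using x False by (intro arccos_cos) (auto simp: field_simps)
    ultimately show ?thesis using sym[OF x] by (simp add: U_def)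
  qed
  have "bounded (u ` {0..1})"
    by (rule compact_imp_bounded[OF compact_continuous_image[OF cont compact_Icc]])
  then obtain B where B: "\<And>x. x \<in> {0..1} \<Longrightarrow> \<bar>u x\<bar> \<le> B"
    by (force simp: bounded_iff)
  then have "B \<ge> 0" using x by force
  have *: "integral {0..1} (\<lambda>x. (u x)\<^sup>2) \<le> e * B" if e: "e > 0" for e
  proof -
    obtain g where g: "real_polynomial_function g" "\<And>y. y \<in> {-1..1} \<Longrightarrow> \<bar>U y - g y\<bar> < e"
      using Stone_Weierstrass_real_polynomial_function[OF compact_Icc U e] by blast
    obtain a n where gs: "g = (\<lambda>y. \<Sum>i\<le>n. a i * y ^ i)"
      using g(1) unfolding real_polynomial_function_iff_sum by blast
    have int: "(\<lambda>x. u x * g (cos (2 * pi * x))) integrable_on {0..1}"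
      unfolding gs by (intro integrable_continuous_real continuous_intros cont)
    have "integral {0..1} (\<lambda>x. u x * g (cos (2 * pi * x)))
       = integral {0..1} (\<lambda>x. \<Sum>i\<le>n. a i * (u x * cos (2 * pi * x) ^ i))"
      by (simp add: gs sum_distrib_left mult_ac)
    also have "\<dots> = (\<Sum>i\<le>n. a i * integral {0..1} (\<lambda>x. u x * cos (2 * pi * x) ^ i))"
      by (subst integral_sum)
         (auto intro!: integrable_continuous_real continuous_intros cont)
    finally have "integral {0..1} (\<lambda>x. u x * g (cos (2 * pi * x))) = 0" by (simp add: mom)
    then have "integral {0..1} (\<lambda>x. (u x)\<^sup>2)
      = integral {0..1} (\<lambda>x. (u x)\<^sup>2) - integral {0..1} (\<lambda>x. u x * g (cos (2 * pi * x)))"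
      by simp
    also have "\<dots> = integral {0..1} (\<lambda>x. (u x)\<^sup>2 - u x * g (cos (2 * pi * x)))"
      by (rule Henstock_Kurzweil_Integration.integral_diff[symmetric, OF _ int])
         (intro integrable_continuous_real continuous_intros cont)
    also have "\<dots> \<le> integral {0..1::real} (\<lambda>x. e * B)"
    proof (rule integral_le)
      show "(\<lambda>x. (u x)\<^sup>2 - u x * g (cos (2 * pi * x))) integrable_on {0..1}"
        by (intro integrable_diff int integrable_continuous_real continuous_intros cont)
      fix x :: real assume x: "x \<in> {0..1}"
      have "(u x)\<^sup>2 - u x * g (cos (2 * pi * x)) = u x * (U (cos (2 * pi * x)) - g (cos (2 * pi * x)))"
        using Uu[OF x] by (simp add: power2_eq_square right_diff_distrib)
      also have "\<dots> \<le> \<bar>u x\<bar> * \<bar>U (cos (2 * pi * x)) - g (cos (2 * pi * x))\<bar>"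
        unfolding abs_mult[symmetric] by simp
      also have "\<dots> \<le> B * e"
        using B[OF x] g(2)[of "cos (2 * pi * x)"] \<open>B \<ge> 0\<close> by (intro mult_mono) auto
      finally show "(u x)\<^sup>2 - u x * g (cos (2 * pi * x)) \<le> e * B" by (simp add: mult.commute)
    qed auto
    finally show ?thesis by simp
  qed
  have "integral {0..1} (\<lambda>x. (u x)\<^sup>2) \<le> 0 + e" if "e > 0" for e
  proof -
    have "integral {0..1} (\<lambda>x. (u x)\<^sup>2) \<le> (e / (B + 1)) * B"
      using that \<open>B \<ge> 0\<close> by (intro *) simp
    also have "\<dots> \<le> e" using that \<open>B \<ge> 0\<close> by (simp add: field_simps)
    finally show ?thesis by simp
  qed
  then have "integral {0..1} (\<lambda>x. (u x)\<^sup>2) \<le> 0" by (rule field_le_epsilon)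
  moreover have "integral {0..1} (\<lambda>x. (u x)\<^sup>2) \<ge> 0"
    by (intro Henstock_Kurzweil_Integration.integral_nonneg integrable_continuous_real continuous_intros
        cont) auto
  ultimately have "integral {0..1} (\<lambda>x. (u x)\<^sup>2) = 0" by simp
  moreover have "continuous_on {0..1} (\<lambda>x. (u x)\<^sup>2)" by (intro continuous_intros cont)
  ultimately have "\<forall>x\<in>{0..1}. (u x)\<^sup>2 = 0" using integral_eq_0_iff[of 0 1 "\<lambda>x. (u x)\<^sup>2"] by simp
  then show ?thesis using x by simp
qed

text \<open>
  Multiplication by \<open>cos (2 \<pi> x)\<close> averages two neighbouring coefficients, so all cosine moments
  vanish with the coefficients; the real and the imaginary part are then treated separately.
\<close>

lemma even_periodic_zero_if_fourier_coeffs_zero: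
  fixes u :: "real \<Rightarrow> complex"
  assumes cont: "continuous_on {0..1} u"
    and sym: "\<And>x. x \<in> {0..1} \<Longrightarrow> u (1 - x) = u x"
    and coeff: "\<And>n::int. integral {0..1} (\<lambda>x. u x * cis (2 * pi * n * x)) = 0"
    and x: "x \<in> {0..1}"
  shows "u x = 0"
proof -
  have int: "(\<lambda>x. u x * cis (2 * pi * n * x) * of_real (cos (2 * pi * x) ^ m)) integrable_on {0..1}" for n
      :: int and m
    by (intro integrable_continuous_real continuous_intros cont)
  have "integral {0..1} (\<lambda>x. u x * cis (2 * pi * n * x) * of_real (cos (2 * pi * x) ^ m))
      = 0" for n :: int and m
  proof (induction m arbitrary: n)
    case 0
    show ?case using coeff[of n] by simp
  next
    case (Suc m)
    have cis: "cis (2 * pi * n * x) * of_real (cos (2 * pi * x)) =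
        (cis (2 * pi * of_int (n + 1) * x) + cis (2 * pi * of_int (n - 1) * x)) / 2" for x
    proof -
      have "of_real (cos (2 * pi * x)) = (cis (2 * pi * x) + cis (- (2 * pi * x))) / 2"
        by (simp add: complex_eq_iff)
      moreover have "2 * pi * of_int (n + 1) * x = 2 * pi * n * x + 2 * pi * x"
        "2 * pi * of_int (n - 1) * x = 2 * pi * n * x + - (2 * pi * x)" by (simp_all add: algebra_simps)
      ultimately show ?thesis by (simp only: cis_mult[symmetric]) (simp add: algebra_simps)
    qed
    have "(\<lambda>x. u x * cis (2 * pi * n * x) * of_real (cos (2 * pi * x) ^ Suc m)) =
      (\<lambda>x. (u x * cis (2 * pi * of_int (n + 1) * x) * of_real (cos (2 * pi * x) ^ m)
           + u x * cis (2 * pi * of_int (n - 1) * x) * of_real (cos (2 * pi * x) ^ m)) / 2)" (is "?f = ?g")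
    proof
      fix x
      have "?f x = u x * (cis (2 * pi * n * x) * of_real (cos (2 * pi * x))) * of_real (cos (2 * pi * x) ^ m)"
        by (simp add: mult_ac)
      also have "\<dots> = ?g x" unfolding cis by (simp add: algebra_simps add_divide_distrib)
      finally show "?f x = ?g x" .
    qed
    then show ?case
      using Suc.IH[of "n + 1"] Suc.IH[of "n - 1"] int[of "n + 1" m] int[of "n - 1" m]
      by (simp add: Henstock_Kurzweil_Integration.integral_add)
  qed
  from this[of 0] have m: "integral {0..1} (\<lambda>x. u x * of_real (cos (2 * pi * x) ^ m)) = 0" for m by simp
  have int: "(\<lambda>x. u x * of_real (cos (2 * pi * x) ^ m)) integrable_on {0..1}" for m
    by (intro integrable_continuous_real continuous_intros cont)
  have "Re (u x) = 0"
  proof (rule even_periodic_zero_if_cos_moments_zero[of "\<lambda>x. Re (u x)"])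
    show "integral {0..1} (\<lambda>x. Re (u x) * cos (2 * pi * x) ^ k) = 0" for k
      using integral_linear[OF int[of k] bounded_linear_Re] m[of k] by (simp add: o_def flip: of_real_power)
  qed (use sym x in \<open>auto intro!: continuous_intros cont\<close>)
  moreover have "Im (u x) = 0"
  proof (rule even_periodic_zero_if_cos_moments_zero[of "\<lambda>x. Im (u x)"])
    show "integral {0..1} (\<lambda>x. Im (u x) * cos (2 * pi * x) ^ k) = 0" for k
      using integral_linear[OF int[of k] bounded_linear_Im] m[of k] by (simp add: o_def flip: of_real_power)
  qed (use sym x in \<open>auto intro!: continuous_intros cont\<close>)
  ultimately show ?thesis by (simp add: complex_eq_iff)
qed

section \<open>Sums over the integers and integrals\<close>

lemma continuous_on_infsum_majorized:
  fixes f :: "int \<Rightarrow> 'a::topological_space \<Rightarrow> complex"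
  assumes "\<And>k. continuous_on S (f k)" "\<And>k x. x \<in> S \<Longrightarrow> norm (f k x) \<le> M k" "M summable_on UNIV"
  shows "continuous_on S (\<lambda>x. \<Sum>\<^sub>\<infinity>k. f k x)"
proof (rule uniform_limit_theorem)
  show "uniform_limit S (\<lambda>X x. \<Sum>k\<in>X. f k x) (\<lambda>x. \<Sum>\<^sub>\<infinity>k. f k x) (finite_subsets_at_top UNIV)"
    using assms by (intro Weierstrass_m_test_general) auto
  show "\<forall>\<^sub>F X in finite_subsets_at_top UNIV. continuous_on S (\<lambda>x. \<Sum>k\<in>X. f k x)"
    by (intro always_eventually allI continuous_on_sum assms)
qed simp

lemma has_sum_integral_majorized:
  fixes f :: "int \<Rightarrow> real \<Rightarrow> complex"
  assumes "\<And>k. continuous_on {a..b} (f k)" "\<And>k x. x \<in> {a..b} \<Longrightarrow> norm (f k x) \<le> M k" "M summable_on UNIV"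
  shows "((\<lambda>k. integral {a..b} (f k)) has_sum integral {a..b} (\<lambda>x. \<Sum>\<^sub>\<infinity>k. f k x)) UNIV"
proof -
  have ul: "uniform_limit {a..b} (\<lambda>X x. \<Sum>k\<in>X. f k x) (\<lambda>x. \<Sum>\<^sub>\<infinity>k. f k x) (finite_subsets_at_top UNIV)"
    using assms by (intro Weierstrass_m_test_general) auto
  obtain I J where IJ: "\<And>X. ((\<lambda>x. \<Sum>k\<in>X. f k x) has_integral I X) {a..b}"
    "((\<lambda>x. \<Sum>\<^sub>\<infinity>k. f k x) has_integral J) {a..b}" "(I \<longlongrightarrow> J) (finite_subsets_at_top UNIV)"
    by (rule uniform_limit_integral[OF ul]) (rule continuous_on_sum, rule assms(1), simp, blast)
  have "\<forall>\<^sub>F X in finite_subsets_at_top UNIV. I X = (\<Sum>k\<in>X. integral {a..b} (f k))"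
  proof (rule eventually_finite_subsets_at_top_weakI)
    fix X :: "int set" assume "finite X"
    then have "integral {a..b} (\<lambda>x. \<Sum>k\<in>X. f k x) = (\<Sum>k\<in>X. integral {a..b} (f k))"
      by (rule integral_sum) (intro integrable_continuous_real assms(1))
    then show "I X = (\<Sum>k\<in>X. integral {a..b} (f k))"
      using integral_unique[OF IJ(1)[of X]] by simp
  qed
  then have "((\<lambda>X. \<Sum>k\<in>X. integral {a..b} (f k)) \<longlongrightarrow> J) (finite_subsets_at_top UNIV)"
    by (rule Lim_transform_eventually[OF IJ(3)])
  then show ?thesis using IJ(2) by (simp add: has_sum_def integral_unique)
qed

text \<open>
  The half-open unit intervals \<open>[k, k + 1)\<close> partition the line; \<open>int_decode\<close> arranges them in a
  sequence, so that countable additivity of the integral applies.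
\<close>

lemma lebesgue_integral_as_unit_intervals:
  fixes f :: "real \<Rightarrow> complex"
  assumes f: "integrable lborel f"
  shows "(LINT y|lborel. f y) = (\<Sum>i. integral {0..1} (\<lambda>x. f (x + of_int (int_decode i))))"
proof -
  define A where "A = (\<lambda>i. {real_of_int (int_decode i) ..< of_int (int_decode i) + 1})"
  have UN: "(\<Union>i. A i) = UNIV"
  proof -
    have "x \<in> A (int_encode \<lfloor>x\<rfloor>)" for x by (simp add: A_def)
    then show ?thesis by blast
  qed
  have disj: "A i \<inter> A j = {}" if "i \<noteq> j" for i j
  proof -
    have "int_decode i = int_decode j" if "x \<in> A i" "x \<in> A j" for x
      using that floor_unique[of "int_decode i" x] floor_unique[of "int_decode j" x] unfolding A_def by simp
    then have "x \<in> A i \<Longrightarrow> x \<in> A j \<Longrightarrow> i = j" for x using inj_int_decode by (metis injD)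
    then show ?thesis using that by blast
  qed
  have si: "set_integrable lborel (A i) f" for i
    unfolding set_integrable_def by (rule integrable_mult_indicator[OF _ f]) (simp add: A_def)
  have A_sets: "A i \<in> sets borel" for i by (simp add: A_def)
  have "(LINT y|lborel. f y) = (LINT y:(\<Union>i. A i)|lborel. f y)"
    by (simp add: UN set_lebesgue_integral_def)
  also have "\<dots> = (\<Sum>i. (LINT y:A i|lborel. f y))"
    by (rule lebesgue_integral_countable_add) (use disj f in \<open>auto simp: UN set_integrable_def A_sets\<close>)
  also have "\<dots> = (\<Sum>i. integral {0..1} (\<lambda>x. f (x + of_int (int_decode i))))"
  proof (rule suminf_cong)
    fix i
    let ?k = "real_of_int (int_decode i)"
    have "(LINT y:A i|lborel. f y) = integral (A i) f"
      by (rule set_borel_integral_eq_integral(2)[OF si])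
    also have "\<dots> = integral {?k..?k+1} f"
    proof (rule integral_subset_negligible)
      have "{?k..?k+1} - A i \<subseteq> {?k + 1}" by (auto simp: A_def)
      then show "negligible ({?k..?k+1} - A i)" by (rule negligible_subset[OF negligible_sing])
    qed (auto simp: A_def)
    also have "\<dots> = integral {0..1} (\<lambda>x. f (x + ?k))"
      using integral_shift_real_ivl[of ?k ?k "?k + 1" f] by simp
    finally show "(LINT y:A i|lborel. f y) = integral {0..1} (\<lambda>x. f (x + ?k))" .
  qed
  finally show ?thesis .
qed

text \<open>
  This computes the Fourier coefficients of a periodized function as values of a Fourier transform
  on the line.
\<close>

lemma integral_periodization:
  fixes f :: "real \<Rightarrow> complex"
  assumes cont: "continuous_on UNIV f" and f: "integrable lborel f"
    and M: "\<And>k x. x \<in> {0..1} \<Longrightarrow> norm (f (x + of_int k)) \<le> M k" "M summable_on UNIV"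
  shows "integral {0..1} (\<lambda>x. \<Sum>\<^sub>\<infinity>k::int. f (x + k)) = (LINT y|lborel. f y)"
proof -
  have c: "continuous_on {0..1} (\<lambda>x. f (x + of_int k))" for k
    by (intro continuous_on_compose2[OF cont] continuous_intros) auto
  have "((\<lambda>k::int. integral {0..1} (\<lambda>x. f (x + k))) has_sum integral {0..1} (\<lambda>x. \<Sum>\<^sub>\<infinity>k::int. f (x + k))) UNIV"
    by (rule has_sum_integral_majorized[OF c M])
  then have "((\<lambda>i. integral {0..1} (\<lambda>x. f (x + int_decode i))) has_sum integral {0..1} (\<lambda>x. \<Sum>\<^sub>\<infinity>k::int. f (x
      + k))) UNIV"
    using has_sum_reindex_bij_betw[OF bij_int_decode, of "\<lambda>k. integral {0..1} (\<lambda>x. f (x + of_int k))"] by simp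
  then show ?thesis
    unfolding lebesgue_integral_as_unit_intervals[OF f] by (rule sums_unique[OF has_sum_imp_sums])
qed

section \<open>Poisson summation for Gaussians\<close>

text \<open>
  A summable bound that is uniform for \<open>x\<close> in a bounded interval. It comes from
  \<open>k\<^sup>2 \<le> 2 (x + k)\<^sup>2 + 2 x\<^sup>2\<close> and \<open>e\<^bsup>-y\<^esup> \<le> 1 / (1 + y)\<close>, which reduce it to the sum of
  \<open>1 / (1 + (q k)\<^sup>2)\<close>.
\<close>

lemma gaussian_comb_majorant:
  assumes p: "p > (0::real)"
  obtains M :: "int \<Rightarrow> real" where "M summable_on UNIV"
    "\<And>k x. \<bar>x\<bar> \<le> X \<Longrightarrow> exp (- pi * p * (x + of_int k)\<^sup>2) \<le> M k"
proof
  define q where "q = sqrt (pi * p / 2)"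
  have q: "q > 0" "q\<^sup>2 = pi * p / 2" using p by (auto simp: q_def)
  define M where "M = (\<lambda>k::int. exp (pi * p * X\<^sup>2) * inverse (1 + (q * of_int k)\<^sup>2))"
  show "M summable_on UNIV"
    unfolding M_def by (intro summable_on_cmult_right dirac_comb_summable_aux q(1))
  show "exp (- pi * p * (x + of_int k)\<^sup>2) \<le> M k" if x: "\<bar>x\<bar> \<le> X" for k x
  proof -
    have "x\<^sup>2 \<le> X\<^sup>2" using x by (metis abs_ge_zero power2_abs power_mono)
    moreover have "(of_int k)\<^sup>2 \<le> 2 * (x + of_int k)\<^sup>2 + 2 * x\<^sup>2"
      using zero_le_power2[of "2 * x + of_int k"] by (simp add: power2_eq_square algebra_simps)
    ultimately have "(of_int k)\<^sup>2 / 2 - X\<^sup>2 \<le> (x + of_int k)\<^sup>2" by simp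
    then have "pi * p * ((of_int k)\<^sup>2 / 2 - X\<^sup>2) \<le> pi * p * (x + of_int k)\<^sup>2"
      using p by (intro mult_left_mono) auto
    then have "- pi * p * (x + of_int k)\<^sup>2 \<le> pi * p * X\<^sup>2 + - (q * of_int k)\<^sup>2"
      unfolding power_mult_distrib q(2) by (simp add: algebra_simps)
    then have "exp (- pi * p * (x + of_int k)\<^sup>2) \<le> exp (pi * p * X\<^sup>2) * exp (- (q * of_int k)\<^sup>2)"
      unfolding exp_add[symmetric] by simp
    also have "exp (- (q * of_int k)\<^sup>2) \<le> inverse (1 + (q * of_int k)\<^sup>2)"
      unfolding exp_minus by (intro le_imp_inverse_le exp_ge_add_one_self) (simp add: add_pos_nonneg)
    finally show ?thesis by (simp add: M_def)
  qed
qed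

lemma continuous_on_gaussian_wave [continuous_intros]:
  assumes "continuous_on S f" "continuous_on S g" "continuous_on S h"
  shows "continuous_on S (\<lambda>x. gaussian_wave (f x) (g x) (h x))"
  unfolding gaussian_wave_def by (intro continuous_intros assms)

lemma gaussian_wave_uminus: "gaussian_wave z \<xi> (- y) = gaussian_wave z (- \<xi>) y"
  by (simp add: gaussian_wave_def)

lemma gaussian_wave_add_freq: "gaussian_wave z (\<xi> + \<eta>) y = gaussian_wave z \<xi> y * cis (2 * pi * \<eta> * y)"
  by (simp add: gaussian_wave_def cis_conv_exp algebra_simps flip: exp_add)

lemma integral_cis_int:
  fixes n :: int
  shows "integral {0..1} (\<lambda>x. cis (2 * pi * n * x)) = (if n = 0 then 1 else 0)"
proof (cases "n = 0")
  case False
  define w where "w = 2 * pi * real_of_int n"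
  have w: "w \<noteq> 0" using False by (simp add: w_def)
  have ii: "\<i> * (u * (\<i> * v)) = - (u * v)" for u v by (simp add: complex_eq_iff)
  have "((\<lambda>x. cis (w * x)) has_integral (cis (w * 1) / (\<i> * w) - cis (w * 0) / (\<i> * w))) {0..1}"
  proof (rule fundamental_theorem_of_calculus)
    show "((\<lambda>x. cis (w * x) / (\<i> * w)) has_vector_derivative cis (w * x)) (at x within {0..1})" for x
      unfolding has_vector_derivative_def using w
      by (auto intro!: derivative_eq_intros simp: fun_eq_iff scaleR_conv_of_real ii)
  qed simp
  moreover have "cis (w * 1) = 1" by (simp add: w_def)
  ultimately show ?thesis using False by (simp add: w_def integral_unique)
qed simp

text \<open>
  The two sides, \<open>g\<close> and \<open>h\<close> below, are continuous and invariant under \<open>x \<mapsto> 1 - x\<close>. The \<open>n\<close>-th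
  coefficient of the periodization \<open>g\<close> is a value of the Fourier transform of the Gaussian, while
  that of the series \<open>h\<close> can be read off; they agree, so \<open>g - h\<close> vanishes.
\<close>

lemma poisson_summation_gaussian:
  assumes z: "Re z > 0" and x: "x \<in> {0..1}"
  shows "(\<Sum>\<^sub>\<infinity>k::int. gaussian_wave z 0 (x + of_int k))
    = (\<Sum>\<^sub>\<infinity>n::int. gaussian_wave (1 / z) x (of_int n)) / csqrt z"
proof -
  have z0: "z \<noteq> 0" using z by auto
  have z': "Re (1 / z) > 0" using z z0 by (simp add: Re_divide sum_power2_gt_zero_iff complex_eq_iff)
  define g where "g = (\<lambda>x. \<Sum>\<^sub>\<infinity>k::int. gaussian_wave z 0 (x + of_int k))"
  define h where "h = (\<lambda>x. \<Sum>\<^sub>\<infinity>n::int. gaussian_wave (1 / z) x (of_int n) / csqrt z)"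
  obtain M where M: "M summable_on UNIV"
    "\<And>k x. \<bar>x\<bar> \<le> 1 \<Longrightarrow> exp (- pi * Re z * (x + of_int k)\<^sup>2) \<le> M k"
    by (rule gaussian_comb_majorant[OF z, of 1]) (rule that)
  obtain M' where M': "M' summable_on UNIV"
    "\<And>k x. \<bar>x\<bar> \<le> 0 \<Longrightarrow> exp (- pi * Re (1 / z) * (x + of_int k)\<^sup>2) \<le> M' k"
    by (rule gaussian_comb_majorant[OF z', of 0]) (rule that)
  have bg: "norm (gaussian_wave z \<xi> (x + of_int k)) \<le> M k" if "x \<in> {0..1}" for \<xi> x k
    unfolding norm_gaussian_wave using that by (intro M) auto
  have bh: "norm (gaussian_wave (1 / z) x (of_int k) / csqrt z) \<le> M' k / norm (csqrt z)" for x k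
    unfolding norm_divide norm_gaussian_wave using M'(2)[of 0 k]
    by (intro divide_right_mono) auto
  have M'': "(\<lambda>k. M' k / norm (csqrt z)) summable_on UNIV" unfolding divide_inverse
      by (intro summable_on_cmult_left M')
  have cg: "continuous_on {0..1} g"
    unfolding g_def by (rule continuous_on_infsum_majorized[OF _ bg M(1)]) (intro continuous_intros)
  have ch: "continuous_on {0..1} h"
    unfolding h_def using z0 by (intro continuous_on_infsum_majorized[OF _ bh M''] continuous_intros) auto
  have "g x - h x = 0"
  proof (rule even_periodic_zero_if_fourier_coeffs_zero[of "\<lambda>x. g x - h x"])
    show "continuous_on {0..1} (\<lambda>x. g x - h x)" by (intro continuous_intros cg ch)
    show "g (1 - x) - h (1 - x) = g x - h x" for x
    proof -
      have "bij (\<lambda>k::int. - 1 - k)" by (rule o_bij[of "\<lambda>k. - 1 - k"]) auto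
      then have "g (1 - x) = (\<Sum>\<^sub>\<infinity>k::int. gaussian_wave z 0 (1 - x + of_int (- 1 - k)))"
        unfolding g_def by (subst infsum_reindex_bij_betw) auto
      also have "\<dots> = g x"
        unfolding g_def
      proof (rule infsum_cong)
        fix k :: int
        have "1 - x + of_int (- 1 - k) = - (x + of_int k)" by simp
        then show "gaussian_wave z 0 (1 - x + of_int (- 1 - k)) = gaussian_wave z 0 (x + of_int k)"
          by (simp only: gaussian_wave_uminus) simp
      qed
      finally have "g (1 - x) = g x" .
      have "bij (\<lambda>k::int. - k)" by (rule o_bij[of "\<lambda>k. - k"]) auto
      then have "h (1 - x) = (\<Sum>\<^sub>\<infinity>k::int. gaussian_wave (1 / z) (1 - x) (of_int (- k)) / csqrt z)"
        unfolding h_def by (subst infsum_reindex_bij_betw) auto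
      also have "\<dots> = h x"
        unfolding h_def
      proof (rule infsum_cong)
        fix k :: int
        have "gaussian_wave (1 / z) (1 - x) (of_int (- k)) = gaussian_wave (1 / z) (x + (-1)) (of_int k)"
          by (simp add: gaussian_wave_uminus)
        also have "\<dots> = gaussian_wave (1 / z) x (of_int k) * cis (2 * pi * of_int (- k))"
          unfolding gaussian_wave_add_freq by simp
        also have "cis (2 * pi * of_int (- k)) = 1" by (rule cis_multiple_2pi) simp
        finally show "gaussian_wave (1 / z) (1 - x) (of_int (- k)) / csqrt z
            = gaussian_wave (1 / z) x (of_int k) / csqrt z"
          by simp
      qed
      finally have "h (1 - x) = h x" .
      with \<open>g (1 - x) = g x\<close> show ?thesis by simp
    qed
    fix n :: int
    have "integral {0..1} (\<lambda>x. g x * cis (2 * pi * n * x))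
        = integral {0..1} (\<lambda>x. \<Sum>\<^sub>\<infinity>k::int. gaussian_wave z n (x + of_int k))"
    proof (rule integral_cong)
      fix x :: real
      have "gaussian_wave z 0 (x + of_int k) * cis (2 * pi * n * x)
          = gaussian_wave z n (x + of_int k)" for k :: int
      proof -
        have "cis (2 * pi * n * (x + k)) = cis (2 * pi * n * x) * cis (2 * pi * of_int (n * k))"
          unfolding cis_mult by (simp add: algebra_simps)
        also have "cis (2 * pi * of_int (n * k)) = 1" by (rule cis_multiple_2pi) simp
        finally show ?thesis using gaussian_wave_add_freq[of z 0 n "x + k"] by simp
      qed
      then show "g x * cis (2 * pi * n * x) = (\<Sum>\<^sub>\<infinity>k::int. gaussian_wave z n (x + of_int k))"
        unfolding g_def by (simp flip: infsum_cmult_left')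
    qed
    also have "\<dots> = (LINT y|lborel. gaussian_wave z n y)"
      by (rule integral_periodization[OF _ _ bg M(1)])
         (auto intro!: continuous_intros integrable_gaussian_wave z)
    also have "\<dots> = gaussian_wave (1 / z) 0 n / csqrt z"
      unfolding fourier_gaussian[OF z] by (simp add: gaussian_wave_def)
    finally have cgn: "integral {0..1} (\<lambda>x. g x * cis (2 * pi * n * x))
        = gaussian_wave (1 / z) 0 n / csqrt z" .
    let ?c = "\<lambda>k::int. gaussian_wave (1 / z) 0 k / csqrt z"
    have ck: "gaussian_wave (1 / z) x (of_int k) / csqrt z * cis (2 * pi * n * x)
        = ?c k * cis (2 * pi * of_int (k + n) * x)" for x k
    proof -
      have "cis (2 * pi * of_int (k + n) * x) = cis (2 * pi * x * k) * cis (2 * pi * n * x)"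
        unfolding cis_mult by (simp add: algebra_simps)
      then show ?thesis using gaussian_wave_add_freq[of "1 / z" 0 x k] by simp
    qed
    \<comment> \<open>Integrating \<open>h\<close> term by term, orthogonality leaves only the term with index \<open>- n\<close>.\<close>
    have "((\<lambda>k. integral {0..1} (\<lambda>x. ?c k * cis (2 * pi * of_int (k + n) * x))) has_sum
        integral {0..1} (\<lambda>x. \<Sum>\<^sub>\<infinity>k. ?c k * cis (2 * pi * of_int (k + n) * x))) UNIV"
    proof (rule has_sum_integral_majorized[OF _ _ M''])
      show "norm (?c k * cis (2 * pi * of_int (k + n) * x)) \<le> M' k / norm (csqrt z)" for k x
        unfolding norm_mult norm_cis mult_1_right by (rule bh)
    qed (intro continuous_intros)
    moreover have "(\<Sum>\<^sub>\<infinity>k. ?c k * cis (2 * pi * of_int (k + n) * x)) = h x * cis (2 * pi * n * x)" for x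
      unfolding h_def infsum_cmult_left'[symmetric] ck ..
    moreover have "integral {0..1} (\<lambda>x. ?c k * cis (2 * pi * of_int (k + n) * x)) = (if k
        = - n then ?c k else 0)" for k
      using integral_cis_int[of "k + n"] by (auto simp: add_eq_0_iff)
    ultimately have "((\<lambda>k. if k = - n then ?c k else 0) has_sum integral {0..1} (\<lambda>x. h x * cis (2 * pi * n
        * x))) UNIV"
      by simp
    moreover have "((\<lambda>k. if k = - n then ?c k else 0) has_sum ?c (- n)) UNIV"
      by (rule has_sum_finite_neutralI[of "{- n}"]) auto
    ultimately have "integral {0..1} (\<lambda>x. h x * cis (2 * pi * n * x)) = ?c (- n)" by (rule has_sum_unique)
    also have "\<dots> = ?c n" by (simp add: gaussian_wave_uminus)
    finally have "integral {0..1} (\<lambda>x. h x * cis (2 * pi * n * x)) = ?c n" .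
    with cgn show "integral {0..1} (\<lambda>x. (g x - h x) * cis (2 * pi * n * x)) = 0"
      unfolding left_diff_distrib
      by (subst Henstock_Kurzweil_Integration.integral_diff)
         (auto intro!: integrable_continuous_real continuous_intros cg ch)
  qed (rule x)
  then show ?thesis by (simp add: g_def h_def divide_inverse infsum_cmult_left')
qed

section \<open>Theta functions with integer characteristics\<close>

text \<open>
  In classical terms this is the theta constant with characteristics \<open>m/2\<close> and \<open>n/2\<close>, the sum of
  \<open>exp(\<pi> i \<tau> (k + m/2)\<^sup>2 + \<pi> i n (k + m/2))\<close>. Integer characteristics are kept instead of their
  residues modulo 2 since \<open>ab\<close> and \<open>cd\<close> occur in this role.
\<close>

definition jacobi_theta :: "int \<Rightarrow> int \<Rightarrow> complex \<Rightarrow> complex" where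
  "jacobi_theta m n \<tau> = (\<Sum>\<^sub>\<infinity>k::int. gaussian_wave (- \<i> * \<tau>) (n / 2) (m / 2 + k))"

lemma jacobi_theta_shift_left: "jacobi_theta (m + 2 * j) n \<tau> = jacobi_theta m n \<tau>"
proof -
  have b: "bij (\<lambda>k::int. k + j)" by (rule o_bij[of "\<lambda>k. k - j"]) auto
  have "jacobi_theta m n \<tau> = (\<Sum>\<^sub>\<infinity>k::int. gaussian_wave (- \<i> * \<tau>) (n / 2) (m / 2 + of_int (k + j)))"
    unfolding jacobi_theta_def
    using infsum_reindex_bij_betw[OF b, of "\<lambda>k. gaussian_wave (- \<i> * \<tau>) (n / 2) (m / 2 + of_int k)"] by simp
  then show ?thesis by (simp add: jacobi_theta_def add_divide_distrib add_ac)
qed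

lemma jacobi_theta_shift_right: "jacobi_theta m (n + 2 * j) \<tau>
    = cis (pi * of_int (j * m)) * jacobi_theta m n \<tau>"
proof -
  have "gaussian_wave (- \<i> * \<tau>) (of_int (n + 2 * j) / 2) (m / 2 + k)
      = cis (pi * of_int (j * m)) * gaussian_wave (- \<i> * \<tau>) (n / 2) (m / 2 + k)" for k :: int
  proof -
    have "cis (2 * pi * j * (m / 2 + k)) = cis (pi * of_int (j * m)) * cis (2 * pi * of_int (j * k))"
      unfolding cis_mult by (simp add: algebra_simps)
    also have "cis (2 * pi * of_int (j * k)) = 1" by (rule cis_multiple_2pi) simp
    finally show ?thesis using gaussian_wave_add_freq[of "- \<i> * \<tau>" "n / 2" j "m / 2 + k"]
      by (simp add: add_divide_distrib)
  qed
  then show ?thesis by (simp add: jacobi_theta_def infsum_cmult_right')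
qed

lemma cis_pi_int_power_eight: "cis (pi * of_int j / 4) ^ 8 = 1"
proof -
  have "cis (pi * of_int j / 4) ^ 8 = cis (2 * pi * of_int j)" unfolding Complex.DeMoivre
      by (rule arg_cong[where f = cis]) simp
  also have "\<dots> = 1" by (rule cis_multiple_2pi) simp
  finally show ?thesis .
qed

lemma jacobi_theta_power_eight_cong:
  assumes "even (m - m')" "even (n - n')"
  shows "jacobi_theta m n \<tau> ^ 8 = jacobi_theta m' n' \<tau> ^ 8"
proof -
  obtain i j where "m - m' = 2 * i" "n - n' = 2 * j" using assms by (elim evenE)
  then have ij: "m = m' + 2 * i" "n = n' + 2 * j" by simp_all
  have "cis (pi * of_int l) ^ 8 = 1" for l
    using cis_pi_int_power_eight[of "4 * l"] by simp
  then show ?thesis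
    unfolding ij jacobi_theta_shift_left jacobi_theta_shift_right power_mult_distrib by (simp only: mult_1)
qed

text \<open>
  With \<open>y = k + m/2\<close> one has \<open>y\<^sup>2 = (m + 1) y - (m\<^sup>2 + 2 m)/4 + (k\<^sup>2 - k)\<close>, and \<open>k\<^sup>2 - k\<close> is even.
\<close>

lemma jacobi_theta_translate:
  "jacobi_theta m n (\<tau> + 1) = cis (pi * of_int (- (m\<^sup>2 + 2 * m)) / 4) * jacobi_theta m (n + m + 1) \<tau>"
proof -
  have "gaussian_wave (- \<i> * (\<tau> + 1)) (n / 2) (m / 2 + k) =
     cis (pi * of_int (- (m\<^sup>2 + 2 * m)) / 4) * gaussian_wave (- \<i> * \<tau>) (of_int (n + m + 1) / 2) (m / 2 +
         k)" (is "?l = ?r") for k :: int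
  proof -
    define y where "y = m / 2 + real_of_int k"
    have "?l = gaussian_wave (- \<i> * \<tau>) (n / 2) y * cis (pi * y\<^sup>2)"
      by (simp add: gaussian_wave_def y_def cis_conv_exp algebra_simps flip: exp_add)
    moreover have "even (k\<^sup>2 - k)" by simp
    then obtain j where "k\<^sup>2 - k = 2 * j" by (elim evenE)
    then have "real_of_int (k\<^sup>2 - k) = of_int (2 * j)" by simp
    then have j: "(real_of_int k)\<^sup>2 = k + 2 * j" by simp
    have "y\<^sup>2 = of_int (- (m\<^sup>2 + 2 * m)) / 4 + of_int (m + 1) * y + 2 * of_int j"
      using j by (simp add: y_def field_simps power2_eq_square)
    then have "pi * y\<^sup>2 = pi * of_int (- (m\<^sup>2 + 2 * m)) / 4 + 2 * pi * (of_int (m + 1) / 2) * y + 2 * pi *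
        of_int j"
      by (simp only:) (simp add: algebra_simps)
    then have "cis (pi * y\<^sup>2) = cis (pi * of_int (- (m\<^sup>2 + 2 * m)) / 4) * cis (2 * pi * (of_int (m + 1) / 2)
        * y) * cis (2 * pi * of_int j)"
      by (simp only: cis_mult)
    moreover have "cis (2 * pi * of_int j) = 1" by (rule cis_multiple_2pi) simp
    moreover have "gaussian_wave (- \<i> * \<tau>) (of_int (n + m + 1) / 2) y
        = gaussian_wave (- \<i> * \<tau>) (n / 2) y * cis (2 * pi * (of_int (m + 1) / 2) * y)"
      unfolding gaussian_wave_add_freq[symmetric] by (simp add: add_divide_distrib add_ac)
    ultimately show ?thesis by (simp add: y_def mult_ac)
  qed
  then show ?thesis by (simp only: jacobi_theta_def infsum_cmult_right')
qed

lemma jacobi_theta_translate_power_eight: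
  "jacobi_theta m n (\<tau> + 1) ^ 8 = jacobi_theta m (n + m + 1) \<tau> ^ 8"
  unfolding jacobi_theta_translate power_mult_distrib cis_pi_int_power_eight by simp

text \<open>
  Poisson summation at \<open>x = m/2\<close>. The characteristic \<open>m\<close> moves from the shift to the frequency.
\<close>

lemma jacobi_theta_invert_poisson:
  assumes "Im \<tau> > 0" "m = 0 \<or> m = 1"
  shows "jacobi_theta 0 m (- 1 / \<tau>) = csqrt (- \<i> * \<tau>) * jacobi_theta m 0 \<tau>"
proof -
  define z where "z = - \<i> * \<tau>"
  have z: "Re z > 0" using assms by (simp add: z_def)
  then have "csqrt z \<noteq> 0" by auto
  have inv: "- \<i> * (- 1 / \<tau>) = 1 / z" by (simp add: z_def divide_inverse)
  have "jacobi_theta 0 m (- 1 / \<tau>) = (\<Sum>\<^sub>\<infinity>k::int. gaussian_wave (1 / z) (m / 2) (of_int k))"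
    unfolding jacobi_theta_def inv by simp
  also have "\<dots> = csqrt z * (\<Sum>\<^sub>\<infinity>k::int. gaussian_wave z 0 (m / 2 + of_int k))"
    using poisson_summation_gaussian[OF z, of "m / 2"] assms(2) \<open>csqrt z \<noteq> 0\<close> by auto
  also have "\<dots> = csqrt (- \<i> * \<tau>) * jacobi_theta m 0 \<tau>"
    by (simp add: jacobi_theta_def z_def)
  finally show ?thesis .
qed

text \<open>
  Modulo 2 the characteristics are \<open>(0,0)\<close>, \<open>(0,1)\<close> or \<open>(1,0)\<close>. Poisson summation covers the first
  two directly, and the third is the second one read at \<open>-1/\<tau>\<close>. The odd characteristic \<open>(1,1)\<close> is
  excluded by the hypothesis.
\<close>

lemma jacobi_theta_invert_power_eight:
  assumes \<tau>: "Im \<tau> > 0" and mn: "even m \<or> even n"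
  shows "jacobi_theta m n (- 1 / \<tau>) ^ 8 = \<tau> ^ 4 * jacobi_theta n m \<tau> ^ 8"
proof -
  have sq: "csqrt (- \<i> * \<tau>) ^ 8 = \<tau> ^ 4" for \<tau>
  proof -
    have "csqrt (- \<i> * \<tau>) ^ 8 = (- \<i> * \<tau>) ^ 4"
      using power_mult[of "csqrt (- \<i> * \<tau>)" 2 4] by simp
    moreover have "(- \<i>) ^ 4 = 1" using power_mult[of "- \<i>" 2 2] by simp
    ultimately show ?thesis by (simp only: power_mult_distrib mult_1)
  qed
  have 0: "jacobi_theta 0 k (- 1 / \<tau>) ^ 8 = \<tau> ^ 4 * jacobi_theta k 0 \<tau> ^ 8" if "Im \<tau> > 0" "k = 0 \<or> k
      = 1" for k \<tau>
    unfolding jacobi_theta_invert_poisson[OF that] power_mult_distrib sq ..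
  have \<tau>': "\<tau> \<noteq> 0" "Im (- 1 / \<tau>) > 0" using \<tau> by (auto simp: Im_divide sum_power2_gt_zero_iff complex_eq_iff)
  have 1: "jacobi_theta 1 0 (- 1 / \<tau>) ^ 8 = \<tau> ^ 4 * jacobi_theta 0 1 \<tau> ^ 8"
    using 0[OF \<tau>'(2), of 1] \<tau>'(1) by (simp add: field_simps power_divide)
  consider "even m" "even n" | "even m" "odd n" | "odd m" "even n" using mn by blast
  then show ?thesis
  proof cases
    case 1
    then show ?thesis
      using 0[OF \<tau>, of 0] jacobi_theta_power_eight_cong[of m 0 n 0] jacobi_theta_power_eight_cong[of n 0 m
          0] by simp
  next
    case 2
    then show ?thesis
      using 0[OF \<tau>, of 1] jacobi_theta_power_eight_cong[of m 0 n 1] jacobi_theta_power_eight_cong[of n 1 m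
          0] by simp
  next
    case 3
    then show ?thesis
      using 1 jacobi_theta_power_eight_cong[of m 1 n 0] jacobi_theta_power_eight_cong[of n 0 m 1] by simp
  qed
qed

lemma continuous_on_jacobi_theta: "continuous_on {\<tau>. Im \<tau> > 0} (jacobi_theta m n)"
proof (rule continuous_at_imp_continuous_on, rule ballI)
  fix \<tau> :: complex assume "\<tau> \<in> {\<tau>. Im \<tau> > 0}"
  then have p: "Im \<tau> / 2 > 0" by simp
  let ?S = "{\<sigma>. Im \<sigma> > Im \<tau> / 2}"
  obtain M where M: "M summable_on UNIV"
    "\<And>k x. \<bar>x\<bar> \<le> \<bar>m / 2\<bar> \<Longrightarrow> exp (- pi * (Im \<tau> / 2) * (x + of_int k)\<^sup>2) \<le> M k"
    by (rule gaussian_comb_majorant[OF p, of "\<bar>m / 2\<bar>"]) (rule that)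
  have "continuous_on ?S (jacobi_theta m n)"
    unfolding jacobi_theta_def
  proof (rule continuous_on_infsum_majorized[OF _ _ M(1)])
    fix \<sigma> and k :: int assume \<sigma>: "\<sigma> \<in> ?S"
    have "norm (gaussian_wave (- \<i> * \<sigma>) (n / 2) (m / 2 + k)) \<le> exp (- pi * (Im \<tau> / 2) * (m / 2 + k)\<^sup>2)"
    proof -
      have "Im \<tau> / 2 * (m / 2 + k)\<^sup>2 \<le> Im \<sigma> * (m / 2 + k)\<^sup>2"
        using \<sigma> by (intro mult_right_mono) auto
      then have "pi * (Im \<tau> / 2 * (m / 2 + k)\<^sup>2) \<le> pi * (Im \<sigma> * (m / 2 + k)\<^sup>2)"
        by (intro mult_left_mono) auto
      then show ?thesis unfolding norm_gaussian_wave by simp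
    qed
    also have "\<dots> \<le> M k" by (rule M(2)) simp
    finally show "norm (gaussian_wave (- \<i> * \<sigma>) (n / 2) (m / 2 + k)) \<le> M k" .
  qed (intro continuous_intros)
  moreover have "open ?S" by (rule open_halfspace_Im_gt)
  ultimately show "isCont (jacobi_theta m n) \<tau>" using p by (simp add: continuous_on_eq_continuous_at)
qed

lemma jacobi_theta_imaginary_nonzero:
  assumes "y > 0"
  shows "jacobi_theta 0 0 (\<i> * of_real y) \<noteq> 0"
proof -
  let ?f = "\<lambda>k::int. exp (- pi * y * (0 + of_int k)\<^sup>2)"
  obtain M where M: "M summable_on UNIV" "\<And>k x. \<bar>x\<bar> \<le> 0 \<Longrightarrow> exp (- pi * y * (x + of_int k)\<^sup>2) \<le> M k"
    by (rule gaussian_comb_majorant[OF assms, of 0]) (rule that)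
  have s: "?f summable_on UNIV"
    by (rule summable_on_comparison_test[OF M(1)]) (use M(2) in auto)
  have "(\<Sum>k\<in>{0}. ?f k) \<le> infsum ?f UNIV" by (rule finite_sum_le_infsum[OF s]) auto
  then have "infsum ?f UNIV \<noteq> 0" by simp
  moreover have "((\<lambda>k. complex_of_real (?f k)) has_sum complex_of_real (infsum ?f UNIV)) UNIV"
    unfolding has_sum_of_real_iff using s by simp
  then have "(\<Sum>\<^sub>\<infinity>k. complex_of_real (?f k)) = complex_of_real (infsum ?f UNIV)" by (rule infsumI)
  moreover have "complex_of_real (?f k) = gaussian_wave (- \<i> * (\<i> * of_real y)) (of_int 0 / 2) (of_int 0 /
      2 + k)" for k
    by (simp add: gaussian_wave_def flip: exp_of_real)
  ultimately show ?thesis by (simp add: jacobi_theta_def)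
qed

section \<open>Action of unimodular matrices on the eighth power\<close>

text \<open>The action of the matrix with rows \<open>(d, -c)\<close> and \<open>(-b, a)\<close>.\<close>

abbreviation moebius :: "int \<Rightarrow> int \<Rightarrow> int \<Rightarrow> int \<Rightarrow> complex \<Rightarrow> complex" where
  "moebius a b c d \<tau> \<equiv> (of_int d * \<tau> - of_int c) / (of_int a - of_int b * \<tau>)"

text \<open>
  The point \<open>\<tau>\<close> stays fixed while the matrix varies: both moves below act on the matrix from the
  left.
\<close>

definition theta_transform :: "complex \<Rightarrow> int \<Rightarrow> int \<Rightarrow> int \<Rightarrow> int \<Rightarrow> bool" where
  "theta_transform \<tau> a b c d \<longleftrightarrow>
    jacobi_theta (a * b) (- (c * d)) (moebius a b c d \<tau>) ^ 8
      = (of_int a - of_int b * \<tau>) ^ 4 * jacobi_theta 0 0 \<tau> ^ 8"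

lemma linear_form_nonzero:
  assumes "Im \<tau> > 0" "a \<noteq> 0 \<or> b \<noteq> 0"
  shows "of_int a - of_int b * \<tau> \<noteq> 0"
  using assms by (auto simp: complex_eq_iff)

lemma moebius_upper_half_plane:
  fixes a b c d :: int
  assumes \<tau>: "Im \<tau> > 0" and det: "a * d - b * c = 1"
  shows "Im (moebius a b c d \<tau>) > 0"
proof -
  have nz: "of_int a - of_int b * \<tau> \<noteq> 0" using det by (intro linear_form_nonzero \<tau>) auto
  have "real_of_int (a * d - b * c) = 1" using det by simp
  then have det': "real_of_int a * d - b * c = 1" by simp
  have "Im ((of_int d * \<tau> - of_int c) * cnj (of_int a - of_int b * \<tau>)) = (real_of_int a * d - b * c) * Im \<tau>"
    by (simp add: algebra_simps)
  then have "Im ((of_int d * \<tau> - of_int c) * cnj (of_int a - of_int b * \<tau>)) = Im \<tau>"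
    by (simp only: det' mult_1)
  then have "Im (moebius a b c d \<tau>) = Im \<tau> / (norm (of_int a - of_int b * \<tau>))\<^sup>2"
    by (simp add: complex_div_cnj[of "of_int d * \<tau> - of_int c"] Im_divide_of_real)
  then show ?thesis using \<tau> nz by simp
qed

text \<open>
  Passing from \<open>\<sigma>\<close> to \<open>\<sigma> + 1\<close> subtracts the row \<open>(a, b)\<close> from \<open>(c, d)\<close>. The new characteristics
  match those of the translated theta function modulo 2 because \<open>ad - bc = 1\<close>.
\<close>

lemma theta_transform_T:
  assumes \<tau>: "Im \<tau> > 0" and det: "a * d - b * c = 1"
  shows "theta_transform \<tau> a b (c - a) (d - b) \<longleftrightarrow> theta_transform \<tau> a b c d"
proof -
  have nz: "of_int a - of_int b * \<tau> \<noteq> 0" using det by (intro linear_form_nonzero \<tau>) auto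
  define \<sigma> where "\<sigma> = moebius a b c d \<tau>"
  have "(of_int (d - b) * \<tau> - of_int (c - a)) / (of_int a - of_int b * \<tau>) = \<sigma> + 1"
    using nz by (simp add: \<sigma>_def field_simps)
  moreover have "jacobi_theta (a * b) (- ((c - a) * (d - b))) (\<sigma> + 1) ^ 8
      = jacobi_theta (a * b) (- (c * d)) \<sigma> ^ 8"
    unfolding jacobi_theta_translate_power_eight
  proof (rule jacobi_theta_power_eight_cong)
    have "- ((c - a) * (d - b)) + a * b + 1 - - (c * d) = (a * d - b * c) + 1 + 2 * (b * c)"
      by (simp add: algebra_simps)
    also have "\<dots> = 2 * (1 + b * c)" unfolding det by simp
    finally show "even (- ((c - a) * (d - b)) + a * b + 1 - - (c * d))" by (simp only: dvd_triv_left)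
  qed simp
  ultimately show ?thesis by (simp add: theta_transform_def \<sigma>_def)
qed

lemma theta_transform_T_power:
  assumes \<tau>: "Im \<tau> > 0" and det: "a * d - b * c = 1"
  shows "theta_transform \<tau> a b (c - n * a) (d - n * b) \<longleftrightarrow> theta_transform \<tau> a b c d"
proof (induction n rule: int_induct[of _ 0])
  case base
  show ?case by simp
next
  case (step1 i)
  have "a * (d - i * b) - b * (c - i * a) = 1" using det by (simp add: algebra_simps)
  from theta_transform_T[OF \<tau> this] step1(2) show ?case by (simp add: algebra_simps)
next
  case (step2 i)
  have "a * (d - (i - 1) * b) - b * (c - (i - 1) * a) = 1" using det by (simp add: algebra_simps)
  from theta_transform_T[OF \<tau> this] step2(2) show ?case by (simp add: algebra_simps)
qed

text \<open>
  Passing from \<open>\<sigma>\<close> to \<open>-1/\<sigma>\<close> replaces the rows \<open>(a, b)\<close>, \<open>(c, d)\<close> by \<open>(-c, -d)\<close>, \<open>(a, b)\<close>. By the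
  determinant condition \<open>ab\<close> and \<open>cd\<close> are not both odd, so the inversion formula applies.
\<close>

lemma theta_transform_S:
  assumes \<tau>: "Im \<tau> > 0" and det: "a * d - b * c = 1" and S: "theta_transform \<tau> (- c) (- d) a b"
  shows "theta_transform \<tau> a b c d"
proof -
  have nz: "of_int a - of_int b * \<tau> \<noteq> 0" "of_int c - of_int d * \<tau> \<noteq> 0"
    using det by (intro linear_form_nonzero \<tau>; auto)+
  define \<sigma> where "\<sigma> = moebius a b c d \<tau>"
  have \<sigma>: "Im \<sigma> > 0" unfolding \<sigma>_def by (rule moebius_upper_half_plane[OF \<tau> det])
  have par: "even (c * d) \<or> even (- (a * b))"
  proof -
    have "odd (a * d - b * c)" unfolding det by simp
    then show ?thesis by auto
  qed
  have "jacobi_theta (c * d) (- (a * b)) (- 1 / \<sigma>) ^ 8 = \<sigma> ^ 4 * jacobi_theta (- (a * b)) (c * d) \<sigma> ^ 8"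
    by (rule jacobi_theta_invert_power_eight[OF \<sigma> par])
  also have "jacobi_theta (- (a * b)) (c * d) \<sigma> ^ 8 = jacobi_theta (a * b) (- (c * d)) \<sigma> ^ 8"
    by (rule jacobi_theta_power_eight_cong) auto
  finally have 1: "jacobi_theta (c * d) (- (a * b)) (- 1 / \<sigma>) ^ 8
      = \<sigma> ^ 4 * jacobi_theta (a * b) (- (c * d)) \<sigma> ^ 8" .
  have 2: "- 1 / \<sigma> = (of_int b * \<tau> - of_int a) / (of_int (- c) - of_int (- d) * \<tau>)"
    using nz unfolding \<sigma>_def by (simp add: divide_simps)
  have 3: "of_int (- c) - of_int (- d) * \<tau> = \<sigma> * (of_int a - of_int b * \<tau>)"
    using nz by (simp add: \<sigma>_def)
  have "jacobi_theta (c * d) (- (a * b)) (- 1 / \<sigma>) ^ 8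
      = (\<sigma> * (of_int a - of_int b * \<tau>)) ^ 4 * jacobi_theta 0 0 \<tau> ^ 8"
    using S[unfolded theta_transform_def, folded 2] unfolding 3 by simp
  then have "\<sigma> ^ 4 * jacobi_theta (a * b) (- (c * d)) \<sigma> ^ 8
      = \<sigma> ^ 4 * ((of_int a - of_int b * \<tau>) ^ 4 * jacobi_theta 0 0 \<tau> ^ 8)"
    unfolding 1 by (simp add: power_mult_distrib)
  moreover have "\<sigma> \<noteq> 0" using \<sigma> by auto
  ultimately show ?thesis unfolding theta_transform_def \<sigma>_def[symmetric] by simp
qed

text \<open>
  Euclidean algorithm on the column \<open>(a, c)\<close>: translations reduce \<open>c\<close> modulo \<open>a\<close>, and the inversion
  moves the remainder into the first row. When \<open>a = 0\<close>, one more inversion leads to \<open>\<plusminus>\<close> the identity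
  matrix.
\<close>

lemma theta_transform_SL2:
  assumes \<tau>: "Im \<tau> > 0" and det: "a * d - b * c = 1"
  shows "theta_transform \<tau> a b c d"
  using det
proof (induction "nat \<bar>a\<bar>" arbitrary: a b c d rule: less_induct)
  case less
  have S: "theta_transform \<tau> a b c d"
    if "theta_transform \<tau> (- (c - n * a)) (- (d - n * b)) a b" for n
  proof -
    have "a * (d - n * b) - b * (c - n * a) = 1" using less.prems by (simp add: algebra_simps)
    from theta_transform_S[OF \<tau> this that] show ?thesis
      using theta_transform_T_power[OF \<tau> less.prems] by simp
  qed
  show ?case
  proof (cases "a = 0")
    case True
    then have bc: "b * c = -1" using less.prems by simp
    then have b: "b * b = 1" by (auto simp: zmult_eq_neg1_iff)
    \<comment> \<open>Here \<open>b = - c = \<plusminus>1\<close>, so \<open>d * b\<close> translations remove \<open>d\<close>.\<close>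
    have "theta_transform \<tau> (- c) (- (d - d * b * b)) 0 b"
    proof -
      have "(c = 1 \<and> b = -1) \<or> (c = -1 \<and> b = 1)" using bc by (auto simp: zmult_eq_neg1_iff mult.commute)
      then show ?thesis by (auto simp: theta_transform_def)
    qed
    then show ?thesis using S[of "d * b"] True by simp
  next
    case False
    define n where "n = c div a"
    have "nat \<bar>- (c - n * a)\<bar> < nat \<bar>a\<bar>"
      using False abs_mod_less[of a c] by (simp add: n_def minus_div_mult_eq_mod)
    moreover have "- (c - n * a) * b - - (d - n * b) * a = 1" using less.prems by (simp add: algebra_simps)
    ultimately have "theta_transform \<tau> (- (c - n * a)) (- (d - n * b)) a b" by (rule less.hyps)
    then show ?thesis by (rule S)
  qed
qed

section \<open>The multiplier as a function of \<open>r\<close>\<close>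

lemma jacobi_theta_moebius_nonzero:
  assumes det: "a * d - b * c = 1" and r: "r > 0"
  shows "jacobi_theta (a * b) (- (c * d))
    (moebius a b c d (\<i> * of_real (r\<^sup>2))) \<noteq> 0"
proof -
  have \<tau>: "Im (\<i> * of_real (r\<^sup>2)) > 0" using r by simp
  have "of_int a - of_int b * (\<i> * of_real (r\<^sup>2)) \<noteq> 0" using det by (intro linear_form_nonzero \<tau>) auto
  moreover have "jacobi_theta 0 0 (\<i> * of_real (r\<^sup>2)) \<noteq> 0" using r
      by (intro jacobi_theta_imaginary_nonzero) simp
  ultimately show ?thesis using theta_transform_SL2[OF \<tau> det] unfolding theta_transform_def by auto
qed

text \<open>
  The value of \<open>\<mu>\<^sub>0\<close> that the Gaussian forces when \<open>\<surd>(r s) e\<^bsup>-\<pi> i \<alpha> / 4\<^esup>\<close> is the conjugate of the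
  principal root of \<open>a + i b r\<^sup>2\<close>.
\<close>

definition theta_multiplier :: "int \<Rightarrow> int \<Rightarrow> int \<Rightarrow> int \<Rightarrow> real \<Rightarrow> complex" where
  "theta_multiplier a b c d r = cnj (csqrt (Complex (of_int a) (of_int b * r\<^sup>2)))
     * jacobi_theta 0 0 (\<i> * of_real (r\<^sup>2)) / jacobi_theta (a * b) (- (c * d))
    (moebius a b c d (\<i> * of_real (r\<^sup>2)))"

lemma theta_multiplier_power_eight:
  assumes det: "a * d - b * c = 1" and r: "r > 0"
  shows "theta_multiplier a b c d r ^ 8 = 1"
proof -
  define j where "j = csqrt (Complex (of_int a) (of_int b * r\<^sup>2))"
  have \<tau>: "Im (\<i> * of_real (r\<^sup>2)) > 0" using r by simp
  have "j ^ 8 = (Complex (of_int a) (of_int b * r\<^sup>2)) ^ 4"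
    using power_mult[of j 2 4] by (simp add: j_def)
  then have "cnj j ^ 8 = cnj (Complex (of_int a) (of_int b * r\<^sup>2)) ^ 4" by (simp flip: complex_cnj_power)
  also have "cnj (Complex (of_int a) (of_int b * r\<^sup>2)) = of_int a - of_int b * (\<i> * of_real (r\<^sup>2))"
    by (simp add: complex_eq_iff)
  finally have "cnj j ^ 8 * jacobi_theta 0 0 (\<i> * of_real (r\<^sup>2)) ^ 8 = jacobi_theta (a * b) (- (c * d))
    (moebius a b c d (\<i> * of_real (r\<^sup>2))) ^ 8"
    using theta_transform_SL2[OF \<tau> det] by (simp only: theta_transform_def)
  then show ?thesis
    unfolding theta_multiplier_def j_def[symmetric] power_divide power_mult_distrib
    using jacobi_theta_moebius_nonzero[OF det r] by (simp only:) simp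
qed

text \<open>
  If \<open>b\<close> is nonzero, \<open>a + i b r\<^sup>2\<close> stays off the branch cut of the root; otherwise the root does not
  depend on \<open>r\<close>.
\<close>

lemma continuous_on_theta_multiplier:
  assumes det: "a * d - b * c = 1"
  shows "continuous_on {0<..} (theta_multiplier a b c d)"
proof -
  have nz: "of_int a - of_int b * (\<i> * of_real (r\<^sup>2)) \<noteq> 0" if "r \<in> {0<..}" for r
    using det that by (intro linear_form_nonzero) auto
  have root: "continuous_on {0<..} (\<lambda>r. csqrt (Complex (of_int a) (of_int b * r\<^sup>2)))"
  proof (cases "b = 0")
    case False
    have "continuous_on {0<..} (\<lambda>r::real. of_int a + \<i> * of_real (of_int b * r\<^sup>2))"
        by (intro continuous_intros)
    then have "continuous_on {0<..} (\<lambda>r. Complex (of_int a) (of_int b * r\<^sup>2))"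
      by (simp add: Complex_eq)
    then show ?thesis using False
      by (intro continuous_on_compose2[OF continuous_on_csqrt]) (auto simp: complex_nonpos_Reals_iff)
  qed simp
  have "continuous_on {0<..} (\<lambda>r. jacobi_theta m n (f r))"
    if "continuous_on {0<..} f" "\<And>r. r \<in> {0<..} \<Longrightarrow> Im (f r) > 0" for m n and f :: "real \<Rightarrow> complex"
    using that by (intro continuous_on_compose2[OF continuous_on_jacobi_theta]) auto
  note theta = this
  have \<tau>: "continuous_on {0<..} (\<lambda>r::real. \<i> * complex_of_real (r\<^sup>2))" by (intro continuous_intros)
  have \<sigma>: "continuous_on {0<..} (\<lambda>r::real. moebius a b c d (\<i> * of_real (r\<^sup>2)))"
    by (rule continuous_on_divide) (intro continuous_intros, intro continuous_intros, rule ballI, rule nz)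
  show ?thesis
    unfolding theta_multiplier_def
  proof (intro continuous_on_divide continuous_on_mult continuous_on_cnj)
    show "continuous_on {0<..} (\<lambda>r. jacobi_theta 0 0 (\<i> * complex_of_real (r\<^sup>2)))"
      by (rule theta[OF \<tau>]) simp
    show "continuous_on {0<..} (\<lambda>r. jacobi_theta (a * b) (- (c * d))
        (moebius a b c d (\<i> * of_real (r\<^sup>2))))"
      by (rule theta[OF \<sigma>], rule moebius_upper_half_plane[OF _ det]) simp
    show "\<forall>r\<in>{0<..}. jacobi_theta (a * b) (- (c * d))
        (moebius a b c d (\<i> * of_real (r\<^sup>2))) \<noteq> 0"
      by (rule ballI, rule jacobi_theta_moebius_nonzero[OF det]) simp
  qed (rule root)
qed

text \<open>
  A continuous function on a connected set with finitely many values is constant.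
\<close>

lemma theta_multiplier_constant:
  assumes det: "a * d - b * c = 1" and r: "r > 0"
  shows "theta_multiplier a b c d r = theta_multiplier a b c d 1"
proof -
  have "theta_multiplier a b c d ` {0<..} \<subseteq> {z. z ^ 8 = 1}" using theta_multiplier_power_eight[OF det] by auto
  moreover have "finite {z::complex. z ^ 8 = 1}" by (rule finite_roots_unity) simp
  ultimately have "finite (theta_multiplier a b c d ` {0<..})" by (rule finite_subset)
  then have "theta_multiplier a b c d constant_on {0<..}"
    by (rule continuous_finite_range_constant[OF connected_Ioi continuous_on_theta_multiplier[OF det]])
  then obtain y where y: "\<And>x. x \<in> {0<..} \<Longrightarrow> theta_multiplier a b c d x = y" unfolding constant_on_def by blast
  have "r \<in> {0<..}" "1 \<in> {0::real<..}" using r by simp_all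
  then show ?thesis using y by simp
qed

section \<open>The Gaussian as a Schwartz function and eigenfunction\<close>

lemma gaussian_wave_1_0: "gaussian_wave 1 0 x = exp (- (pi * x\<^sup>2))"
  by (simp add: gaussian_wave_def flip: exp_of_real)

text \<open>
  The bound rests on \<open>y\<^sup>n \<le> n\<^sup>n e\<^sup>y\<close>, that is on \<open>y / n \<le> e\<^bsup>y/n\<^esup>\<close>.
\<close>

lemma power_times_gaussian_bounded:
  fixes x :: real
  shows "\<bar>x\<bar> ^ n * exp (- (pi * x\<^sup>2)) \<le> 1 + real n ^ n"
proof -
  have le: "y ^ n \<le> real n ^ n * exp y" if "y \<ge> 0" for y :: real
  proof (cases "n = 0")
    case False
    have "y / n \<le> exp (y / n)" using exp_ge_add_one_self[of "y / n"] by linarith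
    then have "(y / n) ^ n \<le> exp (y / n) ^ n" using that by (intro power_mono) auto
    also have "exp (y / n) ^ n = exp y" using False by (simp flip: exp_of_nat_mult)
    finally show ?thesis using False by (simp add: power_divide field_simps)
  qed (use that in simp)
  have "\<bar>x\<bar> ^ n \<le> 1 + (x\<^sup>2) ^ n"
  proof (cases "\<bar>x\<bar> \<le> 1")
    case True
    then have "\<bar>x\<bar> ^ n \<le> 1" by (simp add: power_le_one)
    then show ?thesis by (simp add: add_increasing2)
  next
    case False
    then have "\<bar>x\<bar> ^ n \<le> \<bar>x\<bar> ^ (2 * n)" by (intro power_increasing) auto
    then show ?thesis by (simp add: power_mult)
  qed
  also have "\<dots> \<le> exp (pi * x\<^sup>2) + real n ^ n * exp (pi * x\<^sup>2)"
  proof (intro add_mono)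
    have "x\<^sup>2 \<le> pi * x\<^sup>2" using pi_gt3 by (simp add: mult_le_cancel_right1)
    then have "exp (x\<^sup>2) \<le> exp (pi * x\<^sup>2)" by simp
    then show "(x\<^sup>2) ^ n \<le> real n ^ n * exp (pi * x\<^sup>2)"
      using le[of "x\<^sup>2"] by (meson order_trans mult_left_mono of_nat_0_le_iff zero_le_power zero_le_power2)
  qed simp
  finally show ?thesis by (simp add: exp_minus field_simps)
qed

text \<open>
  The extra power of \<open>x\<close> makes the induction over the coefficients go through.
\<close>

lemma poly_times_gaussian_bounded:
  fixes p :: "complex poly"
  shows "\<exists>B. \<forall>x::real. norm (of_real x ^ m * poly p (of_real x) * gaussian_wave 1 0 x) \<le> B"
proof (induction p arbitrary: m rule: pCons_induct)
  case 0
  show ?case by (auto intro: exI[of _ 0])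
next
  case (pCons a p)
  obtain B where B: "norm (of_real x ^ Suc m * poly p (of_real x) * gaussian_wave 1 0 x) \<le> B" for x :: real
    using pCons.IH[of "Suc m"] by blast
  have "norm (of_real x ^ m * poly (pCons a p) (of_real x) * gaussian_wave 1 0 x)
      \<le> norm a * (1 + real m ^ m) + B" for x :: real
  proof -
    have "of_real x ^ m * poly (pCons a p) (of_real x) * gaussian_wave 1 0 x
      = a * (of_real x ^ m * gaussian_wave 1 0 x) + of_real x ^ Suc m * poly p (of_real x) * gaussian_wave
          1 0 x"
      by (simp add: algebra_simps)
    moreover have "norm (a * (of_real x ^ m * gaussian_wave 1 0 x)) \<le> norm a * (1 + real m ^ m)"
      using power_times_gaussian_bounded[of x m]
      by (simp add: norm_mult norm_power gaussian_wave_1_0 mult_left_mono)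
    ultimately show ?thesis using B[of x] by (simp only:) (rule norm_triangle_mono)
  qed
  then show ?case by blast
qed

lemma has_vector_derivative_poly_gaussian:
  "((\<lambda>x::real. poly p (of_real x) * gaussian_wave 1 0 x) has_vector_derivative
     poly (pderiv p - [:0, 2 * of_real pi:] * p) (of_real x) * gaussian_wave 1 0 x) (at x within S)"
proof -
  have "((\<lambda>z. poly p z * exp (- complex_of_real pi * z\<^sup>2)) has_field_derivative
     poly (pderiv p - [:0, 2 * of_real pi:] * p) (of_real x) * exp (- complex_of_real pi * (of_real x)\<^sup>2))
         (at (of_real x))"
    by (rule derivative_eq_intros poly_DERIV refl)+ (simp add: algebra_simps)
  from has_vector_derivative_real_field[OF this] show ?thesis by (simp add: gaussian_wave_def)
qed

lemma nth_deriv_gaussian: "\<exists>p. nth_deriv n (gaussian_wave 1 0)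
    = (\<lambda>x. poly p (of_real x) * gaussian_wave 1 0 x)"
proof (induction n)
  case 0
  show ?case by (rule exI[of _ 1]) (simp add: nth_deriv_def)
next
  case (Suc n)
  then obtain p where p: "nth_deriv n (gaussian_wave 1 0)
      = (\<lambda>x. poly p (of_real x) * gaussian_wave 1 0 x)" by blast
  have "nth_deriv (Suc n) (gaussian_wave 1 0) = (\<lambda>x. vector_derivative (nth_deriv n (gaussian_wave 1 0))
      (at x))"
    by (simp add: nth_deriv_def)
  also have "\<dots> = (\<lambda>x. poly (pderiv p - [:0, 2 * of_real pi:] * p) (of_real x) * gaussian_wave 1 0 x)"
    unfolding p by (intro ext vector_derivative_at has_vector_derivative_poly_gaussian)
  finally show ?case by blast
qed

lemma gaussian_schwartz: "gaussian_wave 1 0 \<in> schwartz"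
proof -
  have "nth_deriv n (gaussian_wave 1 0) differentiable (at x)" for n x
    using nth_deriv_gaussian[of n] has_vector_derivative_poly_gaussian
    by (metis differentiableI_vector)
  moreover have "bounded (range (\<lambda>x. x ^ m *\<^sub>R nth_deriv n (gaussian_wave 1 0) x))" for n m
  proof -
    obtain p where p: "nth_deriv n (gaussian_wave 1 0) = (\<lambda>x. poly p (of_real x) * gaussian_wave 1 0 x)"
      using nth_deriv_gaussian by blast
    show ?thesis
      unfolding p bounded_iff using poly_times_gaussian_bounded[of m p]
          by (simp add: scaleR_conv_of_real mult.assoc)
  qed
  ultimately show ?thesis by (simp add: schwartz_def)
qed

text \<open>
  The roots have arguments \<open>\<pi>/4\<close> and, in absolute value, less than \<open>\<pi>/4\<close>. Their product therefore
  has positive real part, which selects the right one of the two square roots of \<open>cis \<theta>\<close>.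
\<close>

lemma csqrt_mult_half_planes:
  assumes S: "S > (0::real)" and z: "Re z > 0" and e: "\<i> * S * z = cis \<theta>" and \<theta>: "\<bar>\<theta>\<bar> < pi"
  shows "csqrt (\<i> * S) * csqrt z = cis (\<theta> / 2)"
proof -
  define p q where "p = csqrt (\<i> * S)" and "q = csqrt z"
  have p2: "p\<^sup>2 = \<i> * S" and q2: "q\<^sup>2 = z" by (simp_all add: p_def q_def)
  have "Re q \<ge> 0" using csqrt_principal[of z] by (auto simp: q_def)
  moreover have "(Im q)\<^sup>2 < (Re q)\<^sup>2" using z unfolding q2[symmetric] by (simp add: Re_power2)
  ultimately have q: "\<bar>Im q\<bar> < Re q" by (metis abs_of_nonneg power2_abs power2_less_imp_less
      power_less_imp_less_base abs_ge_zero)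
  have "(Re p)\<^sup>2 = (Im p)\<^sup>2" using arg_cong[OF p2, of Re] by (simp add: Re_power2)
  moreover have "Re p \<ge> 0" using csqrt_principal[of "\<i> * S"] by (auto simp: p_def)
  moreover have "Re p * Im p > 0" using arg_cong[OF p2, of Im] S by (simp add: Im_power2)
  ultimately have p: "Re p > 0" "Im p = Re p"
    by (auto simp: zero_less_mult_iff power2_eq_iff)
  have "Re (p * q) = Re p * (Re q - Im q)" using p by (simp add: algebra_simps)
  also have "\<dots> > 0" using p q by simp
  finally have pos: "Re (p * q) > 0" .
  have "cos (\<theta> / 2) > 0" using \<theta> by (intro cos_gt_zero_pi) auto
  moreover have "(cis (\<theta> / 2))\<^sup>2 = cis \<theta>" by (simp add: Complex.DeMoivre)
  ultimately have "csqrt (cis \<theta>) = cis (\<theta> / 2)" by (intro csqrt_unique) auto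
  moreover have "csqrt (cis \<theta>) = p * q"
    using pos by (intro csqrt_unique) (auto simp: power_mult_distrib p2 q2 e)
  ultimately show ?thesis by (simp add: p_def q_def)
qed

text \<open>
  Multiplying the kernel with the Gaussian in \<open>y\<close> gives a Gaussian with parameter \<open>z = 1 - i C / S\<close>,
  where \<open>S\<close> and \<open>C\<close> are the sine and cosine of \<open>\<pi> \<beta> / 2\<close>. From \<open>S\<^sup>2 + C\<^sup>2 = 1\<close> one gets
  \<open>1 / (S\<^sup>2 z) = 1 + i C / S\<close>, so the quadratic exponents combine to \<open>-\<pi> x\<^sup>2\<close>.
\<close>

lemma frac_fourier_base_gaussian:
  assumes "0 \<le> \<beta>" "\<beta> < 2"
  shows "frac_fourier_base \<beta> (gaussian_wave 1 0) x = cis (- (pi * \<beta> / 4)) * gaussian_wave 1 0 x"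
proof (cases "\<beta> = 0")
  case False
  define S C where "S = sin (pi * \<beta> / 2)" and "C = cos (pi * \<beta> / 2)"
  have range: "pi * \<beta> / 2 > 0" "pi * \<beta> / 2 < pi" using assms False by auto
  then have S: "S > 0" unfolding S_def by (rule sin_gt_zero)
  have "S\<^sup>2 + C\<^sup>2 = 1" by (simp add: S_def C_def)
  then have SC: "complex_of_real S * of_real S + of_real C * of_real C = 1"
    by (simp add: power2_eq_square flip: of_real_mult of_real_add)
  define z where "z = 1 - \<i> * C / S"
  have z: "Re z > 0" by (simp add: z_def)
  have Sz: "S * z = S - \<i> * C" using S by (simp add: z_def field_simps)
  have z0: "z \<noteq> 0" using z by auto
  have zi: "1 / (S * S * z) = 1 + \<i> * C / S"
  proof -
    have "(S - \<i> * C) * (S + \<i> * C) = 1" using SC by (simp add: algebra_simps)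
    then have "S * z * (S + \<i> * C) = 1" by (simp only: Sz)
    moreover have "S * (1 + \<i> * C / S) = S + \<i> * C" using S by (simp add: field_simps)
    moreover have "S * S * z * (1 + \<i> * C / S) = S * z * (S * (1 + \<i> * C / S))"
        by (simp only: of_real_mult mult_ac)
    ultimately have "S * S * z * (1 + \<i> * C / S) = 1" by (simp only:)
    then have "inverse (S * S * z) = 1 + \<i> * C / S" by (rule inverse_unique)
    then show ?thesis by (simp only: inverse_eq_divide)
  qed
  have "frac_kernel \<beta> x y * gaussian_wave 1 0 y
      = exp (pi * \<i> * C / S * x\<^sup>2) * gaussian_wave z (- x / S) y" for y
    using S unfolding frac_kernel_def gaussian_wave_def S_def[symmetric] C_def[symmetric]
        exp_add[symmetric] z_def
    by (intro arg_cong[where f = exp]) (simp add: field_simps)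
  then have "(LINT y|lborel. frac_kernel \<beta> x y * gaussian_wave 1 0 y)
     = exp (pi * \<i> * C / S * x\<^sup>2) * (LINT y|lborel. gaussian_wave z (- x / S) y)" by simp
  also have "\<dots> = exp (pi * \<i> * C / S * x\<^sup>2) * exp (- pi * (- x / S)\<^sup>2 / z) / csqrt z"
    by (simp add: fourier_gaussian[OF z])
  also have "exp (pi * \<i> * C / S * x\<^sup>2) * exp (- pi * (- x / S)\<^sup>2 / z) / csqrt z
      = gaussian_wave 1 0 x / csqrt z"
  proof -
    have "pi * \<i> * C / S * x\<^sup>2 + - pi * (- x / S)\<^sup>2 / z = pi * \<i> * C / S * x\<^sup>2 - pi * x\<^sup>2 * (1 / (S * S * z))"
      by (simp add: power2_eq_square)
    also have "\<dots> = - (pi * x\<^sup>2)" unfolding zi by (simp add: algebra_simps)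
    finally show ?thesis unfolding exp_add[symmetric] by (simp add: gaussian_wave_def)
  qed
  finally have base: "frac_fourier_base \<beta> (gaussian_wave 1 0) x
      = 1 / (csqrt (\<i> * S) * csqrt z) * gaussian_wave 1 0 x"
    using False by (simp add: frac_fourier_base_def S_def)
  have "csqrt (\<i> * S) * csqrt z = cis (pi * \<beta> / 2 / 2)"
  proof (rule csqrt_mult_half_planes[OF S z])
    show "\<i> * S * z = cis (pi * \<beta> / 2)"
      unfolding mult.assoc Sz by (simp add: complex_eq_iff S_def C_def)
    show "\<bar>pi * \<beta> / 2\<bar> < pi" by (simp only: abs_of_pos[OF range(1)] range(2))
  qed
  moreover have "cis (- (pi * \<beta> / 4)) = inverse (cis (pi * \<beta> / 2 / 2))" by simp
  ultimately show ?thesis unfolding base by (simp only: inverse_eq_divide)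
qed (simp add: frac_fourier_base_def)

text \<open>
  The phase \<open>e\<^bsup>-\<pi> i \<alpha> / 4\<^esup>\<close> also holds outside \<open>(-2,2)\<close>, because shifting the exponent by 2 multiplies
  it by the same \<open>-i\<close> that the definition prescribes.
\<close>

lemma frac_fourier_gaussian:
  "frac_fourier \<alpha> (gaussian_wave 1 0) = (\<lambda>x. cis (- (pi * \<alpha> / 4)) * gaussian_wave 1 0 x)"
proof
  fix x :: real
  define k where "k = \<lfloor>\<alpha> / 2\<rfloor>"
  have k: "0 \<le> \<alpha> - 2 * of_int k" "\<alpha> - 2 * of_int k < 2" unfolding k_def by linarith+
  have "(-1) powi k * x = x \<or> (-1) powi k * x = - x" by (cases "even k") (auto simp: power_int_minus_left)
  then have even: "gaussian_wave 1 0 ((-1) powi k * x) = gaussian_wave 1 0 x"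
      by (auto simp: gaussian_wave_1_0)
  have "exp (- (pi * \<i> / 2) * of_int k) * cis (- (pi * (\<alpha> - 2 * of_int k) / 4)) = cis (- (pi * \<alpha> / 4))"
    unfolding cis_conv_exp exp_add[symmetric] by (intro arg_cong[where f = exp]) (simp add: field_simps)
  then show "frac_fourier \<alpha> (gaussian_wave 1 0) x = cis (- (pi * \<alpha> / 4)) * gaussian_wave 1 0 x"
    unfolding frac_fourier_floor k_def[symmetric] frac_fourier_base_gaussian[OF k] even
    by (simp only: mult.assoc[symmetric])
qed

section \<open>The Dirac comb tested on the Gaussian\<close>

text \<open>
  The argument \<open>\<pi> \<alpha> / 4\<close> lies modulo \<open>2 \<pi>\<close> in \<open>(-\<pi>/2, \<pi>/2]\<close>, the range of the principal root,
  exactly if \<open>\<alpha>\<close> lies modulo 8 in \<open>(-2,2]\<close>. Otherwise \<open>\<alpha> - 4\<close> does.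
\<close>

lemma csqrt_of_square_cis:
  assumes rho: "\<rho> > 0" and sq: "z = of_real (\<rho>\<^sup>2) * cis (pi * \<alpha> / 2)"
  shows "csqrt z = (if \<exists>k::int. \<alpha> - 8 * k \<in> {-2<..2} then 1 else -1) * of_real \<rho> * cis (pi * \<alpha> / 4)"
proof -
  have principal: "csqrt z = of_real \<rho> * cis (pi * \<alpha> / 4)"
    if k: "\<alpha> - 8 * of_int k \<in> {-2<..2}" and sq: "z = of_real (\<rho>\<^sup>2) * cis (pi * \<alpha> / 2)" for k :: int and \<alpha>
  proof (rule csqrt_unique)
    show "(of_real \<rho> * cis (pi * \<alpha> / 4))\<^sup>2 = z" by (simp add: sq power_mult_distrib Complex.DeMoivre)
    define \<beta> where "\<beta> = \<alpha> - 8 * of_int k"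
    have "pi * \<alpha> / 4 = pi * \<beta> / 4 + 2 * pi * of_int k" by (simp add: \<beta>_def field_simps)
    then have "cis (pi * \<alpha> / 4) = cis (pi * \<beta> / 4) * cis (2 * pi * of_int k)" by (simp only: cis_mult)
    also have "cis (2 * pi * of_int k) = 1" by (rule cis_multiple_2pi) simp
    finally have cis: "cis (pi * \<alpha> / 4) = cis (pi * \<beta> / 4)" by simp
    show "0 < Re (of_real \<rho> * cis (pi * \<alpha> / 4)) \<or>
        Re (of_real \<rho> * cis (pi * \<alpha> / 4)) = 0 \<and> 0 \<le> Im (of_real \<rho> * cis (pi * \<alpha> / 4))"
    proof (cases "\<beta> = 2")
      case True
      then have "pi * \<beta> / 4 = pi / 2" by simp
      then show ?thesis unfolding cis using rho by simp
    next
      case False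
      then have "-2 < \<beta>" "\<beta> < 2" using k by (auto simp: \<beta>_def)
      then have "pi * (-2) < pi * \<beta>" "pi * \<beta> < pi * 2"
          by (simp_all only: mult_less_cancel_left_pos[OF pi_gt_zero])
      then have "- (pi / 2) < pi * \<beta> / 4" "pi * \<beta> / 4 < pi / 2" by simp_all
      then have "cos (pi * \<beta> / 4) > 0" by (intro cos_gt_zero_pi)
      then show ?thesis unfolding cis using rho by simp
    qed
  qed
  show ?thesis
  proof (cases "\<exists>k::int. \<alpha> - 8 * k \<in> {-2<..2}")
    case True
    then show ?thesis using principal[OF _ sq] by auto
  next
    case False
    define k where "k = \<lceil>(\<alpha> - 6) / 8\<rceil>"
    have "\<alpha> - 8 * of_int k \<notin> {-2<..2}" using False by auto
    moreover have "of_int k - 1 < (\<alpha> - 6) / 8" "(\<alpha> - 6) / 8 \<le> of_int k"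
      using ceiling_correct[of "(\<alpha> - 6) / 8"] by (auto simp: k_def)
    then have "-2 < \<alpha> - 8 * of_int k" "\<alpha> - 8 * of_int k \<le> 6" by (simp_all add: field_simps)
    ultimately have k: "(\<alpha> - 4) - 8 * of_int k \<in> {-2<..2}" by auto
    have "pi * (\<alpha> - 4) / 2 = pi * \<alpha> / 2 - 2 * pi" "pi * (\<alpha> - 4) / 4 = pi * \<alpha> / 4 - pi"
        by (simp_all add: field_simps)
    then have cis: "cis (pi * (\<alpha> - 4) / 2) = cis (pi * \<alpha> / 2)" "cis (pi * (\<alpha> - 4) / 4) = - cis (pi * \<alpha> / 4)"
      by (simp_all only:) (simp_all add: complex_eq_iff cos_diff sin_diff)
    show ?thesis using principal[OF k] sq unfolding cis if_not_P[OF False] by simp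
  qed
qed

text \<open>
  The hypothesis on \<open>r\<^sup>2 s\<^sup>2\<close> expresses that \<open>a/r + i b r\<close> has modulus \<open>s\<close>. With it, \<open>\<sigma> = \<gamma>(i r\<^sup>2)\<close>
  satisfies \<open>\<sigma> s\<^sup>2 = i - t\<close>, so chirp and Gaussian together are the quadratic exponential of
  parameter \<open>\<sigma>\<close> at the points \<open>s x = k + ab/2\<close>.
\<close>

lemma dirac_comb_identity_at_gaussian:
  fixes \<alpha> r s t :: real and a b c d :: int and \<mu> :: complex
  assumes r: "r > 0" and s: "s > 0" and det: "a * d - b * c = 1" and t: "t = a * c / r\<^sup>2 + b * d * r\<^sup>2"
    and ss: "r\<^sup>2 * s\<^sup>2 = a\<^sup>2 + b\<^sup>2 * (r\<^sup>2)\<^sup>2"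
    and eq: "dist_eq (dist_frac_fourier \<alpha> (dirac_comb r))
        (dist_mult (\<lambda>x. \<mu> * exp (- pi * \<i> * t * x\<^sup>2 - pi * \<i> * c * d * s * x))
          (dist_translate (a * b / (2 * s)) (dirac_comb (1 / s))))"
  shows "sqrt (r * s) * cis (- (pi * \<alpha> / 4)) * jacobi_theta 0 0 (\<i> * of_real (r\<^sup>2))
      = \<mu> * jacobi_theta (a * b) (- (c * d))
    (moebius a b c d (\<i> * of_real (r\<^sup>2)))"
proof -
  define \<sigma> where "\<sigma> = moebius a b c d (\<i> * of_real (r\<^sup>2))"
  have nz: "of_int a - of_int b * (\<i> * of_real (r\<^sup>2)) \<noteq> 0"
    using det r by (intro linear_form_nonzero) auto
  have "real_of_int (a * d - b * c) = 1" using det by simp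
  then have det': "r\<^sup>2 * (real_of_int a * d - b * c) = r\<^sup>2" by simp
  have rt: "r\<^sup>2 * t = a * c + b * d * (r\<^sup>2)\<^sup>2" using r by (simp add: t distrib_left power2_eq_square)
  have \<sigma>: "\<sigma> * of_real (s\<^sup>2) = \<i> - t"
  proof -
    define R where "R = r\<^sup>2"
    have R: "R \<noteq> 0" using r by (simp add: R_def)
    let ?N = "of_int d * (\<i> * of_real R) - of_int c" and ?D = "of_int a - of_int b * (\<i> * of_real R)"
      and ?D' = "of_int a + of_int b * (\<i> * of_real R)"
    have N: "?N * ?D' = of_real R * (\<i> - t)"
      using det' rt unfolding R_def[symmetric] by (simp add: complex_eq_iff algebra_simps power2_eq_square)
    have D: "?D * ?D' = of_real R * of_real (s\<^sup>2)"
      using ss unfolding R_def[symmetric] by (simp add: complex_eq_iff algebra_simps power2_eq_square)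
    have "\<sigma> * ?D = ?N"
      by (simp only: \<sigma>_def R_def times_divide_eq_left nonzero_mult_div_cancel_right[OF nz])
    then have "of_real R * (\<sigma> * of_real (s\<^sup>2)) = of_real R * (\<i> - t)"
      by (metis N D mult.assoc mult.commute)
    then show ?thesis using R by simp
  qed
  have lhs: "dist_frac_fourier \<alpha> (dirac_comb r) (gaussian_wave 1 0)
     = sqrt r * cis (- (pi * \<alpha> / 4)) * jacobi_theta 0 0 (\<i> * of_real (r\<^sup>2))"
  proof -
    have "gaussian_wave 1 0 (r * of_int k) = gaussian_wave (- \<i> * (\<i> * of_real (r\<^sup>2))) (of_int 0 / 2)
        (of_int 0 / 2 + of_int k)" for k
      by (simp add: gaussian_wave_def power_mult_distrib mult.assoc)
    then show ?thesis
      by (simp only: dist_frac_fourier_def dirac_comb_def frac_fourier_gaussian jacobi_theta_def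
          infsum_cmult_right' mult.assoc)
  qed
  let ?g = "\<lambda>x::real. \<mu> * exp (- pi * \<i> * t * complex_of_real (x\<^sup>2) - pi * \<i> * c * d * s * x)"
  have rhs: "dist_mult ?g
          (dist_translate (a * b / (2 * s)) (dirac_comb (1 / s))) (gaussian_wave 1 0)
              = sqrt (1 / s) * (\<mu> * jacobi_theta (a * b) (- (c * d)) \<sigma>)"
  proof -
    have summand: "?g (1 / s * of_int k + a * b / (2 * s)) * gaussian_wave 1 0 (1 / s * of_int k + a * b /
        (2 * s))
       = \<mu> * gaussian_wave (- \<i> * \<sigma>) (of_int (- (c * d)) / 2) (of_int (a * b) / 2 + of_int k)" for k :: int
    proof -
      define x where x: "x = 1 / s * of_int k + a * b / (2 * s)"
      define y where "y = real_of_int (a * b) / 2 + of_int k"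
      have y: "y = s * x" using s by (simp add: x y_def field_simps)
      have "- pi * \<i> * t * complex_of_real (x\<^sup>2) - pi * \<i> * c * d * s * x + (- complex_of_real pi * 1 *
          (complex_of_real x)\<^sup>2 + 2 * pi * \<i> * (0::real) * x)
        = - pi * \<i> * c * d * s * x + \<i> * pi * (x * x) * (\<i> - t)"
        by (simp add: algebra_simps power2_eq_square)
      also have "\<dots> = - complex_of_real pi * (- \<i> * \<sigma>) * (complex_of_real y)\<^sup>2 + 2 * pi * \<i> * (of_int (- (c
          * d)) / 2 :: real) * y"
        unfolding \<sigma>[symmetric] y by (simp add: power2_eq_square)
      finally show ?thesis unfolding gaussian_wave_def y_def[symmetric] x[symmetric] mult.assoc
          exp_add[symmetric] by simp
    qed
    show ?thesis
      unfolding dist_mult_def dist_translate_def dirac_comb_def jacobi_theta_def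
          infsum_cmult_right'[symmetric]
        summand ..
  qed
  have "sqrt r * cis (- (pi * \<alpha> / 4)) * jacobi_theta 0 0 (\<i> * of_real (r\<^sup>2))
      = sqrt (1 / s) * (\<mu> * jacobi_theta (a * b) (- (c * d)) \<sigma>)"
    using eq gaussian_schwartz unfolding dist_eq_def lhs[symmetric] rhs[symmetric] by blast
  then have "sqrt s * (sqrt r * cis (- (pi * \<alpha> / 4)) * jacobi_theta 0 0 (\<i> * of_real (r\<^sup>2)))
    = (sqrt s * sqrt (1 / s)) * (\<mu> * jacobi_theta (a * b) (- (c * d)) \<sigma>)" by simp
  moreover have "sqrt s * sqrt (1 / s) = 1" using s by (simp flip: real_sqrt_mult)
  ultimately show ?thesis unfolding \<sigma>_def[symmetric] by (simp add: real_sqrt_mult mult_ac)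
qed

lemma multiplier_value:
  fixes \<alpha> r s t :: real and a b c d :: int and \<mu> :: complex
  assumes r: "r > 0" and s: "s > 0"
    and e: "exp (pi * \<i> / 2 * \<alpha>) = 1 / s * (a / r + \<i> * b * r)"
    and det: "a * d - b * c = 1" and t: "t = a * c / r\<^sup>2 + b * d * r\<^sup>2"
    and eq: "dist_eq (dist_frac_fourier \<alpha> (dirac_comb r))
        (dist_mult (\<lambda>x. \<mu> * exp (- pi * \<i> * t * x\<^sup>2 - pi * \<i> * c * d * s * x))
          (dist_translate (a * b / (2 * s)) (dirac_comb (1 / s))))"
  shows "\<mu> = (if \<exists>k::int. \<alpha> - 8 * k \<in> {-2<..2} then 1 else - 1) * theta_multiplier a b c d 1"
proof -
  define \<rho> where "\<rho> = sqrt (r * s)"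
  have \<rho>: "\<rho> > 0" "\<rho>\<^sup>2 = r * s" using r s by (auto simp: \<rho>_def)
  have "cis (pi * \<alpha> / 2) = 1 / s * (a / r + \<i> * b * r)"
    using e by (simp add: cis_conv_exp mult_ac)
  then have z: "Complex (of_int a) (of_int b * r\<^sup>2) = of_real (\<rho>\<^sup>2) * cis (pi * \<alpha> / 2)"
    using r s unfolding \<rho>(2) by (simp add: complex_eq_iff power2_eq_square)
  have "r\<^sup>2 * s\<^sup>2 = (norm (of_real (\<rho>\<^sup>2) * cis (pi * \<alpha> / 2)))\<^sup>2"
    by (simp add: norm_mult \<rho>(2) power_mult_distrib)
  then have ss: "r\<^sup>2 * s\<^sup>2 = a\<^sup>2 + b\<^sup>2 * (r\<^sup>2)\<^sup>2"
    unfolding z[symmetric] by (simp add: cmod_def power_mult_distrib)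
  define \<epsilon> :: complex where "\<epsilon> = (if \<exists>k::int. \<alpha> - 8 * k \<in> {-2<..2} then 1 else - 1)"
  have \<epsilon>: "\<epsilon> * \<epsilon> = 1" "cnj \<epsilon> = \<epsilon>" by (auto simp: \<epsilon>_def)
  have "cnj (csqrt (Complex (of_int a) (of_int b * r\<^sup>2))) = \<epsilon> * (of_real \<rho> * cis (- (pi * \<alpha> / 4)))"
    unfolding csqrt_of_square_cis[OF \<rho>(1) z] \<epsilon>_def[symmetric] by (simp add: \<epsilon> cis_cnj)
  then have "\<epsilon> * cnj (csqrt (Complex (of_int a) (of_int b * r\<^sup>2))) = of_real \<rho> * cis (- (pi * \<alpha> / 4))"
    using \<epsilon>(1) by (simp flip: mult.assoc)
  then have "\<epsilon> * theta_multiplier a b c d r = \<mu>"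
    using dirac_comb_identity_at_gaussian[OF r s det t ss eq, folded \<rho>_def]
        jacobi_theta_moebius_nonzero[OF det r]
    by (simp add: theta_multiplier_def flip: mult.assoc)
  then show ?thesis using theta_multiplier_constant[OF det r] by (simp add: \<epsilon>_def)
qed

lemma multiplier_value_power_eight:
  fixes \<alpha> r s t :: real and a b c d :: int and \<mu> :: complex
  assumes r: "r > 0" and s: "s > 0"
    and e: "exp (pi * \<i> / 2 * \<alpha>) = 1 / s * (a / r + \<i> * b * r)"
    and det: "a * d - b * c = 1" and t: "t = a * c / r\<^sup>2 + b * d * r\<^sup>2"
    and eq: "dist_eq (dist_frac_fourier \<alpha> (dirac_comb r))
        (dist_mult (\<lambda>x. \<mu> * exp (- pi * \<i> * t * x\<^sup>2 - pi * \<i> * c * d * s * x))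
          (dist_translate (a * b / (2 * s)) (dirac_comb (1 / s))))"
  shows "\<mu> ^ 8 = 1"
  using theta_multiplier_power_eight[OF det zero_less_one]
  unfolding multiplier_value[OF r s e det t eq] power_mult_distrib by simp

theorem theorem1p4:
  shows "\<exists>M :: int \<Rightarrow> int \<Rightarrow> int \<Rightarrow> int \<Rightarrow> bool \<Rightarrow> complex.
    \<forall>(\<alpha>::real) (r::real) (s::real) (a::int) (b::int) (c::int) (d::int) (t::real) (\<mu>\<^sub>0::complex).
      r > 0 \<longrightarrow> s > 0 \<longrightarrow> coprime a b \<longrightarrow>
      exp (pi * \<i> / 2 * \<alpha>) = 1 / s * (a / r + \<i> * b * r) \<longrightarrow>
      a * d - b * c = 1 \<longrightarrow>
      t = a * c / r\<^sup>2 + b * d * r\<^sup>2 \<longrightarrow>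
      \<mu>\<^sub>0 \<noteq> 0 \<longrightarrow>
      dist_eq (dist_frac_fourier \<alpha> (dirac_comb r))
        (dist_mult (\<lambda>x. \<mu>\<^sub>0 * exp (- pi * \<i> * t * x\<^sup>2 - pi * \<i> * c * d * s * x))
          (dist_translate (a * b / (2 * s)) (dirac_comb (1 / s)))) \<longrightarrow>
      \<mu>\<^sub>0 ^ 8 = 1 \<and> \<mu>\<^sub>0 = M a b c d (\<exists>k::int. \<alpha> - 8 * k \<in> {-2<..2})"
  by (rule exI[of _ "\<lambda>a b c d principal. (if principal then 1 else - 1) * theta_multiplier a b c d 1"],
      intro allI impI conjI; (rule multiplier_value_power_eight | rule multiplier_value); assumption)

end
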